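(* Fix $d\in\mathbb{N}_+$, $\lambda>0$, $T\in\mathbb{N}_+$, and let $\mathcal{X}=\{\bm{x}\in\mathbb{R}^d:\|\bm{x}\|_2\le1\}$. Let $\gamma_T(\mathcal{X})=\max_{\bm{x}_1,\dots,\bm{x}_T\in\mathcal{X}}\frac12\ln\det(\bm{I}_T+\lambda^{-2}\mathbf{K}(\mathbf{X}_T,\mathbf{X}_T))$. There exist constants $C_d^{(1)},\dots,C_d^{(5)}>0$ depending only on $d$, a constant $C_\nu>0$ depending only on $\nu$, an absolute constant $C>0$, and constants $C_{d,\nu}^{(1)},C_{d,\nu}^{(2)}>0$ depending only on $d,\nu$, such that: (i) For $k=k_{\mathrm{SE}}$ with lengthscale $\ell$, set $\theta=2\ell^2$ and $c_d=\max\{1,\exp(\frac1e(\frac d2-1))\}$. If $\theta\le e^2c_d$ and $T/(e-1)\ge\lambda^2$, then $$\gamma_T(\mathcal{X})\le\frac{C_d^{(1)}}{\theta^d}\ln^{d+1}\Big(1+\frac{T}{\lambda^2}\Big)+\ln\Big(1+\frac{T}{\lambda^2}\Big)+C_d^{(2)}\exp\Big(-\frac2\theta+\frac1{\theta^2}\Big);$$ and if $\theta>e^2c_d$, then $$\gamma_T(\mathcal{X})\le\frac{C_d^{(3)}}{\ln^d(\frac{\theta}{ec_d})}\ln^{d+1}\Big(1+\frac{T}{\lambda^2}\Big)+C_d^{(4)}\ln\Big(1+\frac{T}{\lambda^2}\Big)+C_d^{(5)}.$$ (ii) For $k=k_{\mathrm{Mat\acute{e}rn}}$ with $\nu>1/2$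 and lengthscale $\ell$, $$\gamma_T(\mathcal{X})\le C(T,\nu,\lambda)\,\overline{\gamma}_T+C,$$ where $C(T,\nu,\lambda)=\max\Big\{1,\ \log_2\Big(1+\frac{\Gamma(\nu)}{C_\nu}\ln\frac{T^2}{\lambda^2}\Big)+\frac1\nu\log_2\Big(\frac{T^2}{\nu\Gamma(\nu)\lambda^2}\Big)+1\Big\}$ and $$\overline{\gamma}_T=C_{d,\nu}^{(1)}\ln\Big(1+\frac{2T}{\lambda^2}\Big)+C_{d,\nu}^{(2)}\Big(\frac{T}{\lambda^2\ell^{2\nu}}\Big)^{\frac{d}{2\nu+d}}\ln^{\frac{2\nu}{2\nu+d}}\Big(1+\frac{2T}{\lambda^2}\Big).$$
   Context: $k_{\mathrm{SE}}(\bm{x},\tilde{\bm{x}})=\exp(-\|\bm{x}-\tilde{\bm{x}}\|_2^2/(2\ell^2))$; $k_{\mathrm{Mat\acute{e}rn}}(\bm{x},\tilde{\bm{x}})=\frac{2^{1-\nu}}{\Gamma(\nu)}(\frac{\sqrt{2\nu}\|\bm{x}-\tilde{\bm{x}}\|_2}{\ell})^{\nu}K_\nu(\frac{\sqrt{2\nu}\|\bm{x}-\tilde{\bm{x}}\|_2}{\ell})$ with $K_\nu$ the modified Bessel function of the second kind. $\mathbf{K}(\mathbf{X}_T,\mathbf{X}_T)=(k(\bm{x}_i,\bm{x}_j))_{i,j\le T}$. *)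

theory Defs
  imports "HOL-Analysis.Analysis" "Jordan_Normal_Form.Determinant"
begin

text \<open>Points of R^d are represented as functions nat => real supported on {..<d}.\<close>

definition ptnorm :: "nat \<Rightarrow> (nat \<Rightarrow> real) \<Rightarrow> real" where
  "ptnorm d x = sqrt (\<Sum>i<d. (x i)^2)"

definition unit_ball :: "nat \<Rightarrow> (nat \<Rightarrow> real) set" where
  "unit_ball d = {x. (\<forall>i\<ge>d. x i = 0) \<and> ptnorm d x \<le> 1}"

definition ptdist :: "nat \<Rightarrow> (nat \<Rightarrow> real) \<Rightarrow> (nat \<Rightarrow> real) \<Rightarrow> real" where
  "ptdist d x y = ptnorm d (\<lambda>i. x i - y i)"

definition k_SE :: "nat \<Rightarrow> real \<Rightarrow> (nat \<Rightarrow> real) \<Rightarrow> (nat \<Rightarrow> real) \<Rightarrow> real" where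
  "k_SE d l x y = exp (- (((ptdist d x y) ^ 2) / (2 * l ^ 2)))"

text \<open>Modified Bessel function of the second kind, integral representation
  K_nu(z) = int_0^infty exp(-z cosh t) cosh(nu t) dt, for z > 0.\<close>
definition besselK :: "real \<Rightarrow> real \<Rightarrow> real" where
  "besselK nu z = integral {0..} (\<lambda>t. exp (- z * cosh t) * cosh (nu * t))"

text \<open>Matern kernel; at distance 0 it takes its limiting (continuous) value 1.\<close>
definition k_Matern :: "nat \<Rightarrow> real \<Rightarrow> real \<Rightarrow> (nat \<Rightarrow> real) \<Rightarrow> (nat \<Rightarrow> real) \<Rightarrow> real" where
  "k_Matern d nu l x y =
     (let r = ptdist d x y in
      if r = 0 then 1
      else 2 powr (1 - nu) / Gamma nu * (sqrt (2 * nu) * r / l) powr nu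
           * besselK nu (sqrt (2 * nu) * r / l))"

definition gram :: "((nat \<Rightarrow> real) \<Rightarrow> (nat \<Rightarrow> real) \<Rightarrow> real) \<Rightarrow> nat \<Rightarrow> (nat \<Rightarrow> nat \<Rightarrow> real) \<Rightarrow> real Matrix.mat" where
  "gram k T xs = Matrix.mat T T (\<lambda>(i, j). k (xs i) (xs j))"

definition info_gain :: "((nat \<Rightarrow> real) \<Rightarrow> (nat \<Rightarrow> real) \<Rightarrow> real) \<Rightarrow> real \<Rightarrow> nat \<Rightarrow> (nat \<Rightarrow> nat \<Rightarrow> real) \<Rightarrow> real" where
  "info_gain k lam T xs = 1/2 * ln (Determinant.det (1\<^sub>m T + (1 / lam^2) \<cdot>\<^sub>m gram k T xs))"

definition max_info_gain :: "((nat \<Rightarrow> real) \<Rightarrow> (nat \<Rightarrow> real) \<Rightarrow> real) \<Rightarrow> real \<Rightarrow> nat \<Rightarrow> (nat \<Rightarrow> real) set \<Rightarrow> real" where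
  "max_info_gain k lam T X = (SUP xs \<in> {xs. \<forall>i<T. xs i \<in> X}. info_gain k lam T xs)"

end

theory Submission
  imports Defs
begin

text \<open>
  If a kernel matrix is dominated, as a quadratic form, by finitely many rank-one terms
  \<open>f f\<^sup>T\<close> plus a positive semidefinite residual \<open>B\<close>, then
  \<open>ln det (I + K)\<close> is at most the sum of the \<open>ln (1 + |f|\<^sup>2)\<close> plus the trace of \<open>B\<close>.
  For the squared exponential kernel,
  \<open>exp (-b |x - y|\<^sup>2) = exp (-b |x|\<^sup>2) exp (-b |y|\<^sup>2) exp (2 b \<langle>x, y\<rangle>)\<close>
  is expanded in monomials with all exponents below \<open>M\<close>; the remainder is positive semidefinite
  with diagonal at most \<open>d (2 b)\<^sup>M / M!\<close>, and \<open>M\<close> is chosen so that the trace of the remainder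
  stays bounded.

  The Matern kernel is a mixture of Gaussians \<open>exp (-b |x - y|\<^sup>2)\<close>. By Fischer's inequality
  the kernel matrix may be replaced by its diagonal blocks for a partition of the ball into cells of
  side \<open>1 / n\<close>. Inside a cell, after rescaling, the components with \<open>b \<le> 1\<close> are approximated by
  polynomials of fixed degree with error \<open>O(b\<^sup>M)\<close> and the others are put into the residual. Averaging
  \<open>min 1 b\<^sup>M\<close> over the mixture gives a residual of size \<open>O((n l)\<^bsup>-2\<nu>\<^esup>)\<close>, and
  balancing it against the \<open>O(n\<^sup>d)\<close> rank-one terms yields the rate.
\<close>

section \<open>Determinants of positive definite matrices\<close>

text \<open>No eigenvalues occur. Determinants are compared through Schur complements, so the basic
  inequalities are inductions on the dimension. Matrices are functions of two indices because a
  leading block is then the same function at a smaller dimension. Splitting off the envelope before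
  expanding leaves a series with nonnegative coefficients. This makes every truncation error
  positive semidefinite, so that only its diagonal has to be estimated. The Matern kernel poses two
  obstacles: components with large \<open>b\<close> have no cheap low-rank approximation on the
  whole ball, and features that contain the envelope would differ for every \<open>b\<close> of the
  mixture. Cells cure the first: in cell coordinates the mass moves to small \<open>b\<close>, a
  degree \<open>M \<ge> 2 * nu\<close> that depends on \<open>nu\<close> alone suffices, and the
  rank grows only with the number of cells. Making the envelope polynomial cures the second. As the
  degree does not grow with \<open>T\<close>, no logarithmic prefactor appears; the one in the claim
  is at least 1.\<close>

definition detn :: "nat \<Rightarrow> (nat \<Rightarrow> nat \<Rightarrow> real) \<Rightarrow> real" where
  "detn n F = Determinant.det (Matrix.mat n n (\<lambda>(i, j). F i j))"

definition qform :: "nat \<Rightarrow> (nat \<Rightarrow> nat \<Rightarrow> real) \<Rightarrow> (nat \<Rightarrow> real) \<Rightarrow> real" where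
  "qform n F v = (\<Sum>i<n. \<Sum>j<n. F i j * v i * v j)"

definition psd :: "nat \<Rightarrow> (nat \<Rightarrow> nat \<Rightarrow> real) \<Rightarrow> bool" where
  "psd n F \<longleftrightarrow> (\<forall>i<n. \<forall>j<n. F i j = F j i) \<and> (\<forall>v. 0 \<le> qform n F v)"

definition posdef :: "nat \<Rightarrow> (nat \<Rightarrow> nat \<Rightarrow> real) \<Rightarrow> bool" where
  "posdef n F \<longleftrightarrow> (\<forall>i<n. \<forall>j<n. F i j = F j i) \<and> (\<forall>v. (\<exists>i<n. v i \<noteq> 0) \<longrightarrow> 0 < qform n F v)"

section \<open>Quadratic forms\<close>

lemma qform_cong:
  "(\<And>i j. i < n \<Longrightarrow> j < n \<Longrightarrow> F i j = G i j) \<Longrightarrow> (\<And>i. i < n \<Longrightarrow> v i = w i) \<Longrightarrow> qform n F v = qform n G w"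
  unfolding qform_def by (intro sum.cong refl) auto

lemma qform_add: "qform n (\<lambda>i j. F i j + G i j) v = qform n F v + qform n G v"
  unfolding qform_def by (simp add: sum.distrib algebra_simps)

lemma qform_cmult: "qform n (\<lambda>i j. c * F i j) v = c * qform n F v"
  unfolding qform_def by (simp add: sum_distrib_left algebra_simps)

lemma qform_sum: "qform n (\<lambda>i j. \<Sum>a\<in>A. F a i j) v = (\<Sum>a\<in>A. qform n (F a) v)"
proof (induction A rule: infinite_finite_induct)
  case (insert x A)
  then show ?case by (simp add: qform_add)
qed (simp_all add: qform_def)

lemma qform_rank_one: "qform n (\<lambda>i j. f i * f j) v = (\<Sum>i<n. f i * v i)\<^sup>2"
  unfolding qform_def power2_eq_square sum_product by (simp add: algebra_simps)

lemma qform_identity: "qform n (\<lambda>i j. if i = j then 1 else 0) v = (\<Sum>i<n. (v i)\<^sup>2)"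
proof -
  have "(\<Sum>j<n. (if i = j then 1 else 0) * v i * v j) = (v i)\<^sup>2" if "i < n" for i
  proof -
    have "(\<Sum>j<n. (if i = j then 1 else 0) * v i * v j) = (\<Sum>j<n. if i = j then v i * v j else 0)"
      by (intro sum.cong) auto
    also have "\<dots> = v i * v i" using that by (simp add: sum.delta)
    finally show ?thesis by (simp add: power2_eq_square)
  qed
  then show ?thesis unfolding qform_def by simp
qed

lemma qform_leading:
  assumes "\<And>i. m \<le> i \<Longrightarrow> i < n \<Longrightarrow> v i = 0" "m \<le> n"
  shows "qform n F v = qform m F v"
proof -
  have inner: "(\<Sum>j<n. F i j * v i * v j) = (\<Sum>j<m. F i j * v i * v j)" for i
    by (rule sum.mono_neutral_right) (use assms in auto)
  have "(\<Sum>i<n. \<Sum>j<m. F i j * v i * v j) = (\<Sum>i<m. \<Sum>j<m. F i j * v i * v j)"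
    by (rule sum.mono_neutral_right) (use assms in auto)
  with inner show ?thesis unfolding qform_def by simp
qed

lemma posdef_pos: "posdef n F \<Longrightarrow> i < n \<Longrightarrow> v i \<noteq> 0 \<Longrightarrow> 0 < qform n F v"
  unfolding posdef_def by auto

lemma posdef_nonneg:
  assumes "posdef n F" shows "0 \<le> qform n F v"
proof (cases "\<exists>i<n. v i \<noteq> 0")
  case True
  then show ?thesis using posdef_pos[OF assms, of _ v] by force
next
  case False
  then have "qform n F v = qform n F (\<lambda>_. 0)" by (intro qform_cong) auto
  then show ?thesis by (simp add: qform_def)
qed

lemma posdef_leading:
  assumes "posdef (Suc n) F" shows "posdef n F"
  unfolding posdef_def
proof (intro conjI allI impI)
  fix v :: "nat \<Rightarrow> real" assume v: "\<exists>i<n. v i \<noteq> 0"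
  let ?v = "\<lambda>i. if i < n then v i else 0"
  obtain i where "i < n" "v i \<noteq> 0" using v by blast
  then have "0 < qform (Suc n) F ?v" by (intro posdef_pos[OF assms, of i]) auto
  also have "\<dots> = qform n F ?v" by (rule qform_leading) auto
  also have "\<dots> = qform n F v" by (rule qform_cong) auto
  finally show "0 < qform n F v" .
qed (use assms in \<open>auto simp: posdef_def\<close>)

text \<open>Column \<open>n\<close> of the identity between \<open>A * adj_mat A\<close> and
  \<open>det A\<close> times the unit matrix. It holds for singular matrices as well, so it may
  serve in the proof that determinants are positive.\<close>

lemma cofactor_solves:
  fixes F :: "nat \<Rightarrow> nat \<Rightarrow> real" and n :: nat
  defines "A \<equiv> Matrix.mat (Suc n) (Suc n) (\<lambda>(i, j). F i j)"
  shows "i \<le> n \<Longrightarrow> (\<Sum>j<Suc n. F i j * cofactor A n j) = (if i = n then detn (Suc n) F else 0)"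
    and "cofactor A n n = detn n F"
proof -
  have A: "A \<in> carrier_mat (Suc n) (Suc n)" by (simp add: A_def)
  show "(\<Sum>j<Suc n. F i j * cofactor A n j) = (if i = n then detn (Suc n) F else 0)" if "i \<le> n"
  proof -
    have "(A * adj_mat A) $$ (i, n) = (\<Sum>j<Suc n. F i j * cofactor A n j)"
      unfolding times_mat_def scalar_prod_def adj_mat_def using that A
      by (auto simp: A_def atLeast0LessThan intro!: sum.cong)
    moreover have "(A * adj_mat A) $$ (i, n) = (if i = n then detn (Suc n) F else 0)"
      using that by (simp add: adj_mat(2)[OF A]) (simp add: A_def detn_def)
    ultimately show ?thesis by simp
  qed
  have "mat_delete A n n = Matrix.mat n n (\<lambda>(i, j). F i j)"
    unfolding mat_delete_def A_def by (rule eq_matI) auto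
  then show "cofactor A n n = detn n F" by (simp add: cofactor_def detn_def)
qed

lemma detn_0 [simp]: "detn 0 F = 1"
  by (simp add: detn_def)

text \<open>The last adjugate column \<open>w\<close> ends in \<open>detn n F\<close>, hence is
  nonzero by induction, and the form takes at \<open>w\<close> the product of two consecutive
  leading determinants.\<close>

lemma detn_pos: "posdef n F \<Longrightarrow> 0 < detn n F"
proof (induction n)
  case (Suc n)
  define w where "w = cofactor (Matrix.mat (Suc n) (Suc n) (\<lambda>(i, j). F i j)) n"
  note w = cofactor_solves[where n = n and F = F, folded w_def]
  have pos: "0 < detn n F" using Suc.IH[OF posdef_leading[OF Suc.prems]] .
  then have "0 < qform (Suc n) F w"
    by (intro posdef_pos[OF Suc.prems lessI]) (simp add: w(2))
  also have "qform (Suc n) F w = (\<Sum>i<Suc n. w i * (\<Sum>j<Suc n. F i j * w j))"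
    unfolding qform_def sum_distrib_left by (simp add: algebra_simps)
  also have "\<dots> = (\<Sum>i<Suc n. w i * (if i = n then detn (Suc n) F else 0))"
    by (intro sum.cong refl) (use w(1) in force)
  also have "\<dots> = detn n F * detn (Suc n) F" using w(2) by simp
  finally show ?case using pos by (simp add: zero_less_mult_iff)
qed simp

text \<open>The Schur complement is the minimum of the quadratic form over vectors with last entry 1;
  the minimiser is the last column of the adjugate.\<close>

lemma detn_Suc_variational:
  assumes F: "posdef (Suc n) F"
  obtains w where "w n = 1" "detn (Suc n) F = detn n F * qform (Suc n) F w"
    "\<And>v. v n = 1 \<Longrightarrow> qform (Suc n) F w \<le> qform (Suc n) F v"
proof -
  define u where "u = cofactor (Matrix.mat (Suc n) (Suc n) (\<lambda>(i, j). F i j)) n"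
  note u = cofactor_solves[where n = n and F = F, folded u_def]
  have pos: "0 < detn n F" using detn_pos[OF posdef_leading[OF F]] .
  define w where "w = (\<lambda>i. u i / detn n F)"
  define s where "s = detn (Suc n) F / detn n F"
  have wn: "w n = 1" using u(2) pos by (simp add: w_def)
  have Fw: "(\<Sum>j<Suc n. F i j * w j) = (if i = n then s else 0)" if "i \<le> n" for i
  proof -
    have "(\<Sum>j<Suc n. F i j * w j) = (\<Sum>j<Suc n. F i j * u j) / detn n F"
      unfolding w_def sum_divide_distrib by simp
    then show ?thesis using u(1)[OF that] by (auto simp: s_def)
  qed
  have cross: "(\<Sum>i<Suc n. \<Sum>j<Suc n. F i j * v i * w j) = v n * s" for v
  proof -
    have "(\<Sum>i<Suc n. \<Sum>j<Suc n. F i j * v i * w j) = (\<Sum>i<Suc n. v i * (\<Sum>j<Suc n. F i j * w j))"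
      unfolding sum_distrib_left by (simp add: algebra_simps)
    also have "\<dots> = (\<Sum>i<Suc n. v i * (if i = n then s else 0))"
      by (intro sum.cong refl) (use Fw in force)
    finally show ?thesis by simp
  qed
  have qw: "qform (Suc n) F w = s" unfolding qform_def cross wn by simp
  have dw: "detn (Suc n) F = detn n F * qform (Suc n) F w"
    using pos by (simp add: qw s_def)
  have "qform (Suc n) F w \<le> qform (Suc n) F v" if vn: "v n = 1" for v
  proof -
    \<comment> \<open>\<open>F\<close> maps \<open>w\<close> to a multiple of the last unit vector,
      so \<open>w\<close> is orthogonal, with respect to the form, to every \<open>h\<close> with
      \<open>h n = 0\<close>. Minimality is then Pythagoras.\<close>
    define h where "h = (\<lambda>i. v i - w i)"
    have "(\<Sum>i<Suc n. \<Sum>j<Suc n. F i j * w i * h j) = (\<Sum>i<Suc n. \<Sum>j<Suc n. F i j * h i * w j)"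
      using F unfolding posdef_def by (subst sum.swap) (intro sum.cong refl, auto)
    then have c2: "(\<Sum>i<Suc n. \<Sum>j<Suc n. F i j * w i * h j) = 0"
      using cross[of h] vn wn by (simp add: h_def del: sum.lessThan_Suc)
    have c1: "(\<Sum>i<Suc n. \<Sum>j<Suc n. F i j * h i * w j) = 0"
      using cross[of h] vn wn by (simp add: h_def del: sum.lessThan_Suc)
    have "qform (Suc n) F v = qform (Suc n) F (\<lambda>i. w i + h i)" by (rule qform_cong) (auto simp: h_def)
    also have "\<dots> = qform (Suc n) F w + qform (Suc n) F h
        + (\<Sum>i<Suc n. \<Sum>j<Suc n. F i j * h i * w j) + (\<Sum>i<Suc n. \<Sum>j<Suc n. F i j * w i * h j)"
      unfolding qform_def sum.distrib[symmetric] by (intro sum.cong refl) (simp add: algebra_simps)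
    finally have "qform (Suc n) F v = qform (Suc n) F w + qform (Suc n) F h" using c1 c2 by linarith
    moreover have "0 \<le> qform (Suc n) F h" by (rule posdef_nonneg[OF F])
    ultimately show ?thesis by simp
  qed
  with wn dw show thesis by (rule that)
qed

text \<open>Each determinant is the previous leading one times a Schur complement, and a smaller
  form has a smaller minimum over \<open>v n = 1\<close>.\<close>

lemma detn_mono:
  assumes "posdef n F" "posdef n G" "\<And>v. qform n F v \<le> qform n G v"
  shows "detn n F \<le> detn n G"
  using assms
proof (induction n)
  case (Suc n)
  obtain w where w: "w n = 1" "detn (Suc n) F = detn n F * qform (Suc n) F w"
    "\<And>v. v n = 1 \<Longrightarrow> qform (Suc n) F w \<le> qform (Suc n) F v"
    using detn_Suc_variational[OF Suc.prems(1)] by blast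
  obtain u where u: "u n = 1" "detn (Suc n) G = detn n G * qform (Suc n) G u"
    using detn_Suc_variational[OF Suc.prems(2)] by blast
  have le: "qform n F v \<le> qform n G v" for v
  proof -
    let ?v = "\<lambda>i. if i < n then v i else 0"
    have "qform n H v = qform (Suc n) H ?v" for H
    proof -
      have "qform (Suc n) H ?v = qform n H ?v" by (rule qform_leading) auto
      also have "\<dots> = qform n H v" by (rule qform_cong) auto
      finally show ?thesis by simp
    qed
    then show ?thesis using Suc.prems(3) by simp
  qed
  have "detn n F \<le> detn n G"
    using Suc.IH[OF posdef_leading[OF Suc.prems(1)] posdef_leading[OF Suc.prems(2)] le] .
  moreover have "qform (Suc n) F w \<le> qform (Suc n) G u"
    using w(3)[of u, OF u(1)] Suc.prems(3)[of u] by linarith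
  moreover have "0 < detn n G" using detn_pos[OF posdef_leading[OF Suc.prems(2)]] .
  moreover have "0 < qform (Suc n) F w"
    by (rule posdef_pos[OF Suc.prems(1) lessI]) (simp add: w(1))
  ultimately show ?case unfolding w(2) u(2) by (intro mult_mono) auto
qed simp

text \<open>The last unit vector competes in the minimum that defines the Schur complement and gives
  the value \<open>F n n\<close>.\<close>

lemma detn_hadamard:
  assumes "posdef n F" shows "detn n F \<le> (\<Prod>i<n. F i i)"
  using assms
proof (induction n)
  case (Suc n)
  obtain w where w: "w n = 1" "detn (Suc n) F = detn n F * qform (Suc n) F w"
    "\<And>v. v n = 1 \<Longrightarrow> qform (Suc n) F w \<le> qform (Suc n) F v"
    using detn_Suc_variational[OF Suc.prems] by blast
  let ?e = "\<lambda>i. if i = n then 1 else 0 :: real"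
  have "qform (Suc n) F ?e = (\<Sum>i<Suc n. \<Sum>j<Suc n. if i = n \<and> j = n then F n n else 0)"
    unfolding qform_def by (intro sum.cong refl) auto
  also have "\<dots> = F n n" by (simp)
  finally have "qform (Suc n) F w \<le> F n n" using w(3)[of ?e] by simp
  moreover have "detn n F \<le> (\<Prod>i<n. F i i)" "0 < detn n F"
    using Suc.IH[OF posdef_leading[OF Suc.prems]] detn_pos[OF posdef_leading[OF Suc.prems]] .
  moreover have "0 < qform (Suc n) F w"
    by (rule posdef_pos[OF Suc.prems(1) lessI]) (simp add: w(1))
  ultimately show ?case unfolding w(2) by (simp, intro mult_mono) auto
qed simp

text \<open>Pinching keeps the pairs of indices with equal label, so the form splits over the
  labels. \<open>A\<close> may contain labels that do not occur, whose summands vanish; later it is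
  the set of all grid cells, occupied or not.\<close>

lemma qform_pinch:
  assumes "finite A" "c ` {..<n} \<subseteq> A"
  shows "qform n (\<lambda>i j. if c i = c j then F i j else 0) v
    = (\<Sum>q\<in>A. qform n F (\<lambda>i. if c i = q then v i else 0))"
proof -
  have "(\<Sum>q\<in>A. qform n F (\<lambda>i. if c i = q then v i else 0))
     = (\<Sum>i<n. \<Sum>j<n. \<Sum>q\<in>A. F i j * (if c i = q then v i else 0) * (if c j = q then v j else 0))"
    unfolding qform_def by (subst sum.swap, intro sum.cong refl, subst sum.swap, simp)
  also have "\<dots> = (\<Sum>i<n. \<Sum>j<n. (if c i = c j then F i j else 0) * v i * v j)"
  proof (intro sum.cong refl)
    fix i j assume ij: "i \<in> {..<n}" "j \<in> {..<n}"
    have "(\<Sum>q\<in>A. F i j * (if c i = q then v i else 0) * (if c j = q then v j else 0))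
      = (\<Sum>q\<in>A. if c i = q then (if c i = c j then F i j else 0) * v i * v j else 0)"
      by (intro sum.cong refl) auto
    also have "\<dots> = (if c i = c j then F i j else 0) * v i * v j"
      using assms ij by (subst sum.delta') auto
    finally show "(\<Sum>q\<in>A. F i j * (if c i = q then v i else 0) * (if c j = q then v j else 0))
      = (if c i = c j then F i j else 0) * v i * v j" .
  qed
  finally show ?thesis unfolding qform_def ..
qed

lemma posdef_pinch:
  assumes "posdef n F" shows "posdef n (\<lambda>i j. if c i = c j then F i j else 0)"
  unfolding posdef_def
proof (intro conjI allI impI)
  fix v :: "nat \<Rightarrow> real" assume "\<exists>i<n. v i \<noteq> 0"
  then obtain i where i: "i < n" "v i \<noteq> 0" by blast
  note nn = posdef_nonneg[OF assms]
  have "0 < qform n F (\<lambda>j. if c j = c i then v j else 0)"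
    by (rule posdef_pos[OF assms i(1)]) (use i in simp)
  then have "0 < (\<Sum>q\<in>c ` {..<n}. qform n F (\<lambda>i. if c i = q then v i else 0))"
    using i nn by (intro sum_pos2[of _ "c i"]) auto
  then show "0 < qform n (\<lambda>i j. if c i = c j then F i j else 0) v"
    by (subst qform_pinch[of "c ` {..<n}"]) auto
qed (use assms in \<open>auto simp: posdef_def\<close>)

text \<open>Fischer's inequality: a minimiser for the pinched form may be cut down to the block of the last
  index, where both forms agree.\<close>

lemma detn_pinch:
  assumes "posdef n F"
  shows "detn n F \<le> detn n (\<lambda>i j. if c i = c j then F i j else 0)"
  using assms
proof (induction n)
  case (Suc n)
  let ?G = "\<lambda>i j. if c i = c j then F i j else 0"
  have G: "posdef (Suc n) ?G" by (rule posdef_pinch[OF Suc.prems])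
  obtain w where w: "w n = 1" "detn (Suc n) F = detn n F * qform (Suc n) F w"
    "\<And>v. v n = 1 \<Longrightarrow> qform (Suc n) F w \<le> qform (Suc n) F v"
    using detn_Suc_variational[OF Suc.prems] by blast
  obtain u where u: "u n = 1" "detn (Suc n) ?G = detn n ?G * qform (Suc n) ?G u"
    using detn_Suc_variational[OF G] by blast
  note nn = posdef_nonneg[OF Suc.prems]
  have "qform (Suc n) F w \<le> qform (Suc n) F (\<lambda>i. if c i = c n then u i else 0)"
    by (rule w(3)) (simp add: u)
  also have "\<dots> \<le> (\<Sum>q\<in>c ` {..<Suc n}. qform (Suc n) F (\<lambda>i. if c i = q then u i else 0))"
    using nn by (intro member_le_sum[of "c n" _ "\<lambda>q. qform (Suc n) F (\<lambda>i. if c i = q then u i else 0)"]) auto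
  also have "\<dots> = qform (Suc n) ?G u"
    by (subst qform_pinch[of "c ` {..<Suc n}"]) auto
  finally have "qform (Suc n) F w \<le> qform (Suc n) ?G u" .
  moreover have "detn n F \<le> detn n ?G"
    using Suc.IH[OF posdef_leading[OF Suc.prems(1)]] .
  moreover have "0 < detn n ?G" using detn_pos[OF posdef_leading[OF G]] .
  moreover have "0 < qform (Suc n) F w"
    by (rule posdef_pos[OF Suc.prems(1) lessI]) (simp add: w(1))
  ultimately show ?case unfolding w(2) u(2) by (intro mult_mono) auto
qed simp

text \<open>With \<open>g = (f, 1)\<close>, the matrix \<open>F\<close> padded by zeros plus
  \<open>g g^T\<close> is the product of the block matrices \<open>(1, f; 0, 1)\<close> and
  \<open>(F, 0; f^T, 1)\<close>, the first of determinant 1.\<close>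

lemma detn_bordered:
  "detn (Suc n) (\<lambda>i j. (if i < n \<and> j < n then F i j else 0) + (if i < n then f i else 1) * (if j < n then f j else 1))
    = detn n F" (is "detn (Suc n) ?G = _")
proof -
  let ?U = "four_block_mat (1\<^sub>m n) (Matrix.mat n 1 (\<lambda>(i, j). f i)) (0\<^sub>m 1 n) (1\<^sub>m 1)"
  let ?V = "four_block_mat (Matrix.mat n n (\<lambda>(i, j). F i j)) (0\<^sub>m n 1) (Matrix.mat 1 n (\<lambda>(i, j). f j)) (1\<^sub>m 1)"
  have "Matrix.mat (Suc n) (Suc n) (\<lambda>(i, j). ?G i j) = ?U * ?V"
    by (subst mult_four_block_mat[of _ n n _ 1 _ 1 _ _ n _ 1], simp_all)
       (intro eq_matI, auto simp: scalar_prod_def)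
  moreover have "Determinant.det ?U = 1"
    by (subst det_four_block_mat_lower_left_zero[of _ n _ 1]) auto
  moreover have "Determinant.det ?V = detn n F"
    by (subst det_four_block_mat_upper_right_zero[of _ n _ 1]) (auto simp: detn_def)
  moreover have "Determinant.det (?U * ?V) = Determinant.det ?U * Determinant.det ?V"
    by (rule det_mult[of _ "Suc n"]) auto
  ultimately show ?thesis unfolding detn_def[of "Suc n"] by simp
qed

lemma posdef_of_ge_identity:
  assumes "\<And>i j. i < n \<Longrightarrow> j < n \<Longrightarrow> F i j = F j i" "\<And>v. (\<Sum>i<n. (v i)\<^sup>2) \<le> qform n F v"
  shows "posdef n F"
  unfolding posdef_def
proof (intro conjI allI impI)
  fix v :: "nat \<Rightarrow> real" assume "\<exists>i<n. v i \<noteq> 0"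
  then have "0 < (\<Sum>i<n. (v i)\<^sup>2)" by (auto intro!: sum_pos2)
  then show "0 < qform n F v" using assms(2)[of v] by linarith
qed (use assms in auto)

text \<open>The bordered matrix with last row \<open>(f, 1)\<close> has determinant \<open>det M\<close>, and the Schur complement
  of its corner is at least \<open>min\<^sub>v (|v|\<^sup>2 + (f \<sqdot> v + 1)\<^sup>2) = 1 / (1 + |f|\<^sup>2)\<close>.\<close>

lemma detn_rank_one_update:
  assumes sym: "\<And>i j. i < n \<Longrightarrow> j < n \<Longrightarrow> F i j = F j i"
    and ge: "\<And>v. (\<Sum>i<n. (v i)\<^sup>2) \<le> qform n F v"
  shows "detn n (\<lambda>i j. F i j + f i * f j) \<le> detn n F * (1 + (\<Sum>i<n. (f i)\<^sup>2))"
proof -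
  define g where "g = (\<lambda>i. if i < n then f i else 1)"
  define G where "G = (\<lambda>i j. (if i < n \<and> j < n then F i j else 0) + g i * g j)"
  have qG: "qform (Suc n) G v = qform n F v + ((\<Sum>i<n. f i * v i) + v n)\<^sup>2" for v
  proof -
    have "qform (Suc n) (\<lambda>i j. if i < n \<and> j < n then F i j else 0) v = qform n F v"
      unfolding qform_def by (auto intro!: sum.cong)
    moreover have "(\<Sum>i<Suc n. g i * v i) = (\<Sum>i<n. f i * v i) + v n" by (simp add: g_def)
    ultimately show ?thesis unfolding G_def qform_add qform_rank_one by simp
  qed
  have G: "posdef (Suc n) G" unfolding posdef_def
  proof (intro conjI allI impI)
    fix i j assume "i < Suc n" "j < Suc n"
    then show "G i j = G j i" using sym by (auto simp: G_def)
  next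
    fix v :: "nat \<Rightarrow> real" assume v: "\<exists>i<Suc n. v i \<noteq> 0"
    show "0 < qform (Suc n) G v"
    proof (cases "\<exists>i<n. v i \<noteq> 0")
      case True
      then have "0 < (\<Sum>i<n. (v i)\<^sup>2)" by (auto intro!: sum_pos2)
      then show ?thesis unfolding qG using ge[of v] by (smt (verit) zero_le_power2)
    next
      case False
      then have "v n \<noteq> 0" "(\<Sum>i<n. f i * v i) = 0" using v less_Suc_eq by auto
      moreover have "0 \<le> qform n F v" using ge[of v] by (smt (verit) sum_nonneg zero_le_power2)
      ultimately show ?thesis unfolding qG by (simp add: add_nonneg_pos)
    qed
  qed
  obtain w where w: "w n = 1" "detn (Suc n) G = detn n G * qform (Suc n) G w"
    using detn_Suc_variational[OF G] by blast
  \<comment> \<open>The leading block of \<open>G\<close> is the updated matrix, while the full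
    determinant of \<open>G\<close> is the old one. A lower bound for the Schur complement therefore
    bounds the update from above.\<close>
  have dG: "detn n G = detn n (\<lambda>i j. F i j + f i * f j)"
    unfolding detn_def G_def g_def by (intro arg_cong[of _ _ Determinant.det] eq_matI) auto
  have dF: "detn (Suc n) G = detn n F"
    using detn_bordered[of n F f] unfolding G_def g_def .
  define a where "a = (\<Sum>i<n. f i * w i)"
  define p where "p = (\<Sum>i<n. (f i)\<^sup>2)"
  define q where "q = (\<Sum>i<n. (w i)\<^sup>2)"
  have "a\<^sup>2 \<le> p * q"
    unfolding a_def p_def q_def by (rule Cauchy_Schwarz_ineq_sum)
  moreover have p0: "0 \<le> p" "0 \<le> q" by (auto simp: p_def q_def intro: sum_nonneg)
  moreover have "(1 + p) * (q + (a + 1)\<^sup>2) = q + (p * q - a\<^sup>2) + (a + 1)\<^sup>2 * p + a\<^sup>2 + (a + 1)\<^sup>2"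
    by (simp add: algebra_simps)
  \<comment> \<open>Cauchy-Schwarz gives \<open>q \<ge> a\<^sup>2 / p\<close>; with equality the
    left side exceeds 1 by exactly \<open>(a + p * (a + 1))\<^sup>2 / p\<close>. For
    \<open>p = 0\<close> it forces \<open>a = 0\<close>.\<close>
  moreover have "(1 + p) * (q + (a + 1)\<^sup>2) \<ge> 1"
  proof (cases "p = 0")
    case True
    then have "a = 0" using \<open>a\<^sup>2 \<le> p * q\<close> by simp
    then show ?thesis using True p0 by simp
  next
    case False
    then have pp: "p > 0" using p0 by simp
    then have "q \<ge> a\<^sup>2 / p" using \<open>a\<^sup>2 \<le> p * q\<close> by (simp add: field_simps)
    then have "(1 + p) * (q + (a + 1)\<^sup>2) \<ge> (1 + p) * (a\<^sup>2 / p + (a + 1)\<^sup>2)"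
      using pp by (intro mult_left_mono) auto
    moreover have "(1 + p) * (a\<^sup>2 / p + (a + 1)\<^sup>2) - 1 = (a + p * (a + 1))\<^sup>2 / p"
      using pp by (simp add: field_simps power2_eq_square)
    moreover have "(a + p * (a + 1))\<^sup>2 / p \<ge> 0" using pp by simp
    ultimately show ?thesis by linarith
  qed
  moreover have "q + (a + 1)\<^sup>2 \<le> qform (Suc n) G w"
    unfolding qG w(1) q_def a_def using ge[of w] by simp
  ultimately have "1 \<le> (1 + p) * qform (Suc n) G w"
    by (smt (verit) mult_left_mono)
  moreover have "0 < detn n G" using detn_pos[OF posdef_leading[OF G]] .
  ultimately have "detn n G * 1 \<le> detn n G * ((1 + p) * qform (Suc n) G w)"
    by (intro mult_left_mono) auto
  also have "\<dots> = detn n F * (1 + p)" using w(2) dF by simp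
  finally show ?thesis unfolding dG p_def by simp
qed

text \<open>Dominating the identity survives the addition of each square, so the rank-one estimate
  can be iterated, always with the norm of the new vector alone.\<close>

lemma detn_finite_rank_update:
  assumes "finite J" and sym: "\<And>i j. i < n \<Longrightarrow> j < n \<Longrightarrow> F i j = F j i"
    and ge: "\<And>v. (\<Sum>i<n. (v i)\<^sup>2) \<le> qform n F v"
  shows "detn n (\<lambda>i j. F i j + (\<Sum>a\<in>J. f a i * f a j)) \<le> detn n F * (\<Prod>a\<in>J. 1 + (\<Sum>i<n. (f a i)\<^sup>2))"
  using assms(1)
proof (induction J rule: finite_induct)
  case (insert x J)
  let ?H = "\<lambda>i j. F i j + (\<Sum>a\<in>J. f a i * f a j)"
  have "detn n (\<lambda>i j. ?H i j + f x i * f x j) \<le> detn n ?H * (1 + (\<Sum>i<n. (f x i)\<^sup>2))"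
  proof (rule detn_rank_one_update)
    fix v :: "nat \<Rightarrow> real"
    have "0 \<le> (\<Sum>a\<in>J. (\<Sum>i<n. f a i * v i)\<^sup>2)" by (intro sum_nonneg) auto
    then show "(\<Sum>i<n. (v i)\<^sup>2) \<le> qform n ?H v"
      using ge[of v] by (simp add: qform_add qform_sum qform_rank_one)
  qed (use sym in \<open>auto simp: mult.commute\<close>)
  also have "\<dots> \<le> (detn n F * (\<Prod>a\<in>J. 1 + (\<Sum>i<n. (f a i)\<^sup>2))) * (1 + (\<Sum>i<n. (f x i)\<^sup>2))"
    by (intro mult_right_mono insert.IH add_nonneg_nonneg sum_nonneg) auto
  finally show ?case using insert.hyps by (simp add: algebra_simps)
qed simp

text \<open>Fischer's inequality discards the entries between different labels first, so only the
  pinched form has to be dominated; a constant labelling means no pinching. The squares are then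
  peeled off down to \<open>I + B\<close>, where Hadamard's inequality and
  \<open>1 + x \<le> exp x\<close> leave the trace.\<close>

lemma ln_detn_le:
  assumes "finite J" and K: "psd n K" and B: "psd n B"
    and le: "\<And>v. qform n (\<lambda>i j. if c i = c j then K i j else 0) v
                \<le> (\<Sum>a\<in>J. (\<Sum>i<n. f a i * v i)\<^sup>2) + qform n B v"
  shows "ln (detn n (\<lambda>i j. (if i = j then 1 else 0) + K i j))
    \<le> (\<Sum>a\<in>J. ln (1 + (\<Sum>i<n. (f a i)\<^sup>2))) + (\<Sum>i<n. B i i)"
proof -
  let ?I = "\<lambda>i j. if i = j then 1 else 0 :: real"
  let ?IK = "\<lambda>i j. ?I i j + K i j" and ?IB = "\<lambda>i j. ?I i j + B i j"
  let ?P = "\<lambda>i j. if c i = c j then ?IK i j else 0"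
  let ?S = "\<lambda>i j. ?IB i j + (\<Sum>a\<in>J. f a i * f a j)"
  have IK: "posdef n ?IK"
    by (rule posdef_of_ge_identity) (use K in \<open>auto simp: psd_def qform_add qform_identity\<close>)
  have IB: "posdef n ?IB"
    by (rule posdef_of_ge_identity) (use B in \<open>auto simp: psd_def qform_add qform_identity\<close>)
  have S: "posdef n ?S"
  proof (rule posdef_of_ge_identity)
    fix v :: "nat \<Rightarrow> real"
    have "0 \<le> (\<Sum>a\<in>J. (\<Sum>i<n. f a i * v i)\<^sup>2)" by (intro sum_nonneg) auto
    then show "(\<Sum>i<n. (v i)\<^sup>2) \<le> qform n ?S v"
      using B by (simp add: psd_def qform_add qform_identity qform_sum qform_rank_one add_nonneg_nonneg)
  qed (use B in \<open>auto simp: psd_def mult.commute\<close>)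
  have P: "?P i j = ?I i j + (if c i = c j then K i j else 0)" for i j by auto
  have "detn n ?IK \<le> detn n ?P" by (rule detn_pinch[OF IK])
  also have "\<dots> \<le> detn n ?S"
  proof (rule detn_mono[OF posdef_pinch[OF IK] S])
    fix v :: "nat \<Rightarrow> real"
    show "qform n ?P v \<le> qform n ?S v"
      using le[of v] unfolding P by (simp add: qform_add qform_identity qform_sum qform_rank_one)
  qed
  also have "\<dots> \<le> detn n ?IB * (\<Prod>a\<in>J. 1 + (\<Sum>i<n. (f a i)\<^sup>2))"
    by (rule detn_finite_rank_update[OF \<open>finite J\<close>])
       (use B in \<open>auto simp: psd_def qform_add qform_identity\<close>)
  finally have main: "detn n ?IK \<le> detn n ?IB * (\<Prod>a\<in>J. 1 + (\<Sum>i<n. (f a i)\<^sup>2))" .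
  have fpos: "0 < 1 + (\<Sum>i<n. (f a i)\<^sup>2)" for a by (simp add: add_pos_nonneg sum_nonneg)
  have Bpos: "0 \<le> B k k" if "k < n" for k
  proof -
    let ?e = "\<lambda>i. if i = k then 1 else 0 :: real"
    have "qform n B ?e = (\<Sum>i<n. \<Sum>j<n. if i = k then (if j = k then B k k else 0) else 0)"
      unfolding qform_def by (intro sum.cong refl) auto
    also have "\<dots> = (\<Sum>i<n. if i = k then B k k else 0)"
      by (intro sum.cong refl) (use that in auto)
    also have "\<dots> = B k k" using that by simp
    finally show ?thesis using B by (metis psd_def)
  qed
  have "detn n ?IB \<le> (\<Prod>i<n. 1 + B i i)" using detn_hadamard[OF IB] by simp
  also have "\<dots> \<le> (\<Prod>i<n. exp (B i i))"
    by (intro prod_mono) (use Bpos in \<open>auto simp: exp_ge_add_one_self\<close>)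
  also have "\<dots> = exp (\<Sum>i<n. B i i)" by (simp add: exp_sum)
  finally have "detn n ?IB \<le> exp (\<Sum>i<n. B i i)" .
  then have "ln (detn n ?IB) \<le> (\<Sum>i<n. B i i)"
    using ln_mono[OF _ detn_pos[OF IB]] by fastforce
  moreover have "ln (detn n ?IK) \<le> ln (detn n ?IB) + (\<Sum>a\<in>J. ln (1 + (\<Sum>i<n. (f a i)\<^sup>2)))"
  proof -
    have "0 < (\<Prod>a\<in>J. 1 + (\<Sum>i<n. (f a i)\<^sup>2))" using fpos by (intro prod_pos) auto
    then have "ln (detn n ?IK) \<le> ln (detn n ?IB * (\<Prod>a\<in>J. 1 + (\<Sum>i<n. (f a i)\<^sup>2)))"
      using main detn_pos[OF IK] detn_pos[OF IB] by (subst ln_le_cancel_iff) auto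
    also have "\<dots> = ln (detn n ?IB) + ln (\<Prod>a\<in>J. 1 + (\<Sum>i<n. (f a i)\<^sup>2))"
      using \<open>0 < (\<Prod>a\<in>J. 1 + (\<Sum>i<n. (f a i)\<^sup>2))\<close> detn_pos[OF IB] by (intro ln_mult_pos) auto
    also have "ln (\<Prod>a\<in>J. 1 + (\<Sum>i<n. (f a i)\<^sup>2)) = (\<Sum>a\<in>J. ln (1 + (\<Sum>i<n. (f a i)\<^sup>2)))"
      by (rule ln_prod[OF \<open>finite J\<close>]) (rule less_imp_neq[OF fpos, symmetric])
    finally show ?thesis .
  qed
  ultimately show ?thesis by linarith
qed

section \<open>Low-rank approximation of the Gaussian kernel\<close>

text \<open>Test vectors \<open>(1, 1)\<close> and \<open>(1, -1)\<close>. It turns a diagonal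
  estimate of a kernel into a uniform one.\<close>

lemma psd_offdiag_le:
  assumes "psd 2 F" shows "\<bar>F 0 1\<bar> \<le> (F 0 0 + F 1 1) / 2"
proof -
  have q: "qform 2 F v = F 0 0 * (v 0)\<^sup>2 + F 0 1 * v 0 * v 1 + F 1 0 * v 0 * v 1 + F 1 1 * (v 1)\<^sup>2" for v
    by (simp add: qform_def numeral_2_eq_2 power2_eq_square)
  have s: "F 1 0 = F 0 1" using assms by (simp add: psd_def)
  have "0 \<le> qform 2 F (\<lambda>_. 1)" "0 \<le> qform 2 F (\<lambda>i. if i = 0 then 1 else - 1)"
    using assms by (simp_all add: psd_def)
  then show ?thesis unfolding q s by auto
qed

lemma psd_add: "psd n F \<Longrightarrow> psd n G \<Longrightarrow> psd n (\<lambda>i j. F i j + G i j)"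
  by (auto simp: psd_def qform_add)

lemma psd_cmult: "psd n F \<Longrightarrow> 0 \<le> c \<Longrightarrow> psd n (\<lambda>i j. c * F i j)"
  by (auto simp: psd_def qform_cmult)

section \<open>Taylor remainders of the exponential\<close>

lemma divide_fact_le: "0 \<le> a \<Longrightarrow> a / fact M \<le> (a :: real)"
  using divide_left_mono[of 1 "fact M" a] by (simp add: fact_ge_1)

lemma exp_taylor_remainder_bounds:
  fixes z :: real assumes "0 \<le> z"
  shows "(\<Sum>k<M. z ^ k / fact k) \<le> exp z" "exp z - (\<Sum>k<M. z ^ k / fact k) \<le> exp z * z ^ M / fact M"
proof -
  obtain t where t: "\<bar>t\<bar> \<le> \<bar>z\<bar>" "exp z = (\<Sum>m<M. z ^ m / fact m) + exp t / fact M * z ^ M"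
    using Maclaurin_exp_le by blast
  have "0 \<le> exp t / fact M * z ^ M" using assms by simp
  then show "(\<Sum>k<M. z ^ k / fact k) \<le> exp z" using t(2) by linarith
  have "exp t * z ^ M / fact M \<le> exp z * z ^ M / fact M"
    using t(1) assms by (intro divide_right_mono mult_right_mono) auto
  then show "exp z - (\<Sum>k<M. z ^ k / fact k) \<le> exp z * z ^ M / fact M" using t(2) by simp
qed

text \<open>Meant for the envelope, whose exponent is negative. There the degree is fixed, so the
  factorial can be given away.\<close>

lemma exp_taylor_remainder_abs:
  fixes z :: real
  shows "\<bar>exp z - (\<Sum>k<M. z ^ k / fact k)\<bar> \<le> exp \<bar>z\<bar> * \<bar>z\<bar> ^ M"
proof -
  obtain t where t: "\<bar>t\<bar> \<le> \<bar>z\<bar>" "exp z = (\<Sum>m<M. z ^ m / fact m) + exp t / fact M * z ^ M"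
    using Maclaurin_exp_le by blast
  have "\<bar>exp t / fact M * z ^ M\<bar> = exp t / fact M * \<bar>z\<bar> ^ M"
    by (simp add: abs_mult power_abs)
  also have "exp t / fact M \<le> exp t" by (rule divide_fact_le) simp
  then have "exp t / fact M * \<bar>z\<bar> ^ M \<le> exp t * \<bar>z\<bar> ^ M" by (rule mult_right_mono) simp
  also have "\<dots> \<le> exp \<bar>z\<bar> * \<bar>z\<bar> ^ M" using t(1) by (intro mult_right_mono) auto
  finally show ?thesis using t(2) by simp
qed

section \<open>Monomial expansion of the Gaussian kernel\<close>

definition sqnorm :: "nat \<Rightarrow> (nat \<Rightarrow> real) \<Rightarrow> real" where
  "sqnorm d x = (\<Sum>i<d. (x i)\<^sup>2)"

definition gauss :: "nat \<Rightarrow> real \<Rightarrow> (nat \<Rightarrow> real) \<Rightarrow> (nat \<Rightarrow> real) \<Rightarrow> real" where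
  "gauss d b x y = exp (- b * (\<Sum>i<d. (x i - y i)\<^sup>2))"

text \<open>A box of exponents, not a simplex of total degree: truncation then acts on each
  coordinate separately and the truncated kernel is a product of one-dimensional sums.\<close>

definition exponent_box :: "nat \<Rightarrow> nat \<Rightarrow> (nat \<Rightarrow> nat) set" where
  "exponent_box d M = PiE {..<d} (\<lambda>_. {..<M})"

definition monom_at :: "nat \<Rightarrow> (nat \<Rightarrow> nat) \<Rightarrow> (nat \<Rightarrow> real) \<Rightarrow> real" where
  "monom_at d \<alpha> x = (\<Prod>i<d. x i ^ \<alpha> i)"

definition taylor_coeff :: "nat \<Rightarrow> real \<Rightarrow> (nat \<Rightarrow> nat) \<Rightarrow> real" where
  "taylor_coeff d b \<alpha> = (\<Prod>i<d. (2 * b) ^ \<alpha> i / fact (\<alpha> i))"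

definition gauss_low :: "nat \<Rightarrow> real \<Rightarrow> nat \<Rightarrow> (nat \<Rightarrow> real) \<Rightarrow> (nat \<Rightarrow> real) \<Rightarrow> real" where
  "gauss_low d b M x y = (\<Sum>\<alpha>\<in>exponent_box d M. taylor_coeff d b \<alpha> *
     ((exp (- b * sqnorm d x) * monom_at d \<alpha> x) * (exp (- b * sqnorm d y) * monom_at d \<alpha> y)))"

lemma finite_exponent_box [simp]: "finite (exponent_box d M)"
  by (simp add: exponent_box_def finite_PiE)

lemma card_exponent_box: "card (exponent_box d M) = M ^ d"
  by (simp add: exponent_box_def card_PiE)

lemma taylor_coeff_nonneg: "0 \<le> b \<Longrightarrow> 0 \<le> taylor_coeff d b \<alpha>"
  unfolding taylor_coeff_def by (intro prod_nonneg) auto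

lemma gauss_low_eq:
  "gauss_low d b M x y = exp (- b * sqnorm d x) * exp (- b * sqnorm d y)
     * (\<Prod>i<d. \<Sum>k<M. (2 * b * x i * y i) ^ k / fact k)"
proof -
  have "(\<Prod>i<d. \<Sum>k<M. (2 * b * x i * y i) ^ k / fact k)
      = (\<Sum>\<alpha>\<in>exponent_box d M. \<Prod>i<d. (2 * b * x i * y i) ^ \<alpha> i / fact (\<alpha> i))"
    unfolding exponent_box_def by (rule prod_sum_PiE) auto
  also have "\<dots> = (\<Sum>\<alpha>\<in>exponent_box d M. taylor_coeff d b \<alpha> * (monom_at d \<alpha> x * monom_at d \<alpha> y))"
    unfolding taylor_coeff_def monom_at_def prod.distrib[symmetric]
    by (intro sum.cong prod.cong refl) (simp add: power_mult_distrib)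
  finally show ?thesis unfolding gauss_low_def by (simp add: sum_distrib_left algebra_simps)
qed

lemma gauss_eq_prod:
  "gauss d b x y = exp (- b * sqnorm d x) * exp (- b * sqnorm d y) * (\<Prod>i<d. exp (2 * b * x i * y i))"
proof -
  have "- b * (\<Sum>i<d. (x i - y i)\<^sup>2) = - b * sqnorm d x + - b * sqnorm d y + (\<Sum>i<d. 2 * b * x i * y i)"
    unfolding sqnorm_def sum_distrib_left sum.distrib[symmetric]
    by (intro sum.cong refl) (simp add: power2_eq_square algebra_simps)
  then show ?thesis unfolding gauss_def by (simp only: exp_add exp_sum[OF finite_lessThan])
qed

lemma gauss_low_tendsto: "(\<lambda>N. gauss_low d b N x y) \<longlonglongrightarrow> gauss d b x y"
proof -
  have "(\<lambda>N. \<Sum>k<N. z ^ k / fact k) \<longlonglongrightarrow> exp z" for z :: real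
    using exp_converges[of z] unfolding sums_def by (simp add: field_simps)
  then show ?thesis unfolding gauss_low_eq gauss_eq_prod by (intro tendsto_intros)
qed

lemma qform_gauss_low:
  "qform n (\<lambda>i j. gauss_low d b M (X i) (X j)) v
    = (\<Sum>\<alpha>\<in>exponent_box d M. taylor_coeff d b \<alpha> * (\<Sum>i<n. exp (- b * sqnorm d (X i)) * monom_at d \<alpha> (X i) * v i)\<^sup>2)"
  unfolding gauss_low_def qform_sum qform_cmult qform_rank_one ..

lemma gauss_sym: "gauss d b x y = gauss d b y x"
  unfolding gauss_def
  by (intro arg_cong[of _ _ exp] arg_cong2[of _ _ _ _ "(*)"] refl sum.cong power2_commute)

lemma gauss_low_sym: "gauss_low d b M x y = gauss_low d b M y x"
  unfolding gauss_low_def by (intro sum.cong refl arg_cong2[of _ _ _ _ "(*)"] mult.commute)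

text \<open>For \<open>N \<ge> M\<close> the difference of two truncations is a sum of squares with
  nonnegative coefficients over the additional exponents; the residual is its limit as
  \<open>N\<close> grows.\<close>

lemma psd_gauss_residual:
  assumes "0 \<le> b"
  shows "psd n (\<lambda>i j. gauss d b (X i) (X j) - gauss_low d b M (X i) (X j))"
  unfolding psd_def
proof (intro conjI allI impI)
  fix v
  have "0 \<le> qform n (\<lambda>i j. gauss_low d b N (X i) (X j) - gauss_low d b M (X i) (X j)) v" if "M \<le> N" for N
  proof -
    have sub: "exponent_box d M \<subseteq> exponent_box d N" unfolding exponent_box_def by (rule PiE_mono) (use that in auto)
    have "qform n (\<lambda>i j. gauss_low d b M (X i) (X j)) v \<le> qform n (\<lambda>i j. gauss_low d b N (X i) (X j)) v"
      unfolding qform_gauss_low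
      by (rule sum_mono2[OF _ sub]) (auto intro!: mult_nonneg_nonneg taylor_coeff_nonneg assms)
    then show ?thesis
      using qform_add[of n "\<lambda>i j. gauss_low d b N (X i) (X j)" "\<lambda>i j. (-1) * gauss_low d b M (X i) (X j)" v]
      unfolding qform_cmult by simp
  qed
  then have "eventually (\<lambda>N. 0 \<le> qform n (\<lambda>i j. gauss_low d b N (X i) (X j) - gauss_low d b M (X i) (X j)) v) sequentially"
    by (rule eventually_sequentiallyI)
  moreover have "(\<lambda>N. qform n (\<lambda>i j. gauss_low d b N (X i) (X j) - gauss_low d b M (X i) (X j)) v)
     \<longlonglongrightarrow> qform n (\<lambda>i j. gauss d b (X i) (X j) - gauss_low d b M (X i) (X j)) v"
    unfolding qform_def by (intro tendsto_intros gauss_low_tendsto)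
  ultimately show "0 \<le> qform n (\<lambda>i j. gauss d b (X i) (X j) - gauss_low d b M (X i) (X j)) v"
    by (intro tendsto_lowerbound[of _ _ sequentially]) auto
next
  fix i j
  show "gauss d b (X i) (X j) - gauss_low d b M (X i) (X j) = gauss d b (X j) (X i) - gauss_low d b M (X j) (X i)"
    using gauss_sym[of d b "X i" "X j"] gauss_low_sym[of d b M "X i" "X j"] by simp
qed

lemma psd_gauss_low:
  assumes "0 \<le> b" shows "psd n (\<lambda>i j. gauss_low d b M (X i) (X j))"
  unfolding psd_def qform_gauss_low
proof (intro conjI allI impI)
  fix v show "0 \<le> (\<Sum>\<alpha>\<in>exponent_box d M. taylor_coeff d b \<alpha> * (\<Sum>i<n. exp (- b * sqnorm d (X i)) * monom_at d \<alpha> (X i) * v i)\<^sup>2)"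
    by (intro sum_nonneg mult_nonneg_nonneg taylor_coeff_nonneg assms) auto
qed (rule gauss_low_sym)

lemma psd_gauss: "0 \<le> b \<Longrightarrow> psd n (\<lambda>i j. gauss d b (X i) (X j))"
  using psd_add[OF psd_gauss_residual[of b n d X 0] psd_gauss_low[of b n d 0 X]] by simp

text \<open>The one-point case of \<open>psd_gauss_residual\<close>. It bounds the total size of all
  features at a point, hence each of them.\<close>

lemma gauss_low_diag_le:
  assumes "0 \<le> b" shows "gauss_low d b M x x \<le> 1"
proof -
  have "0 \<le> qform 1 (\<lambda>i j. gauss d b x x - gauss_low d b M x x) (\<lambda>_. 1)"
    using psd_gauss_residual[OF assms, of 1 d "\<lambda>_. x" M] by (simp add: psd_def)
  then show ?thesis by (simp add: qform_def gauss_def)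
qed

text \<open>On the diagonal the envelope factors as well, and \<open>t i\<close> is the probability
  that a Poisson variable of mean \<open>z i\<close> is at least \<open>M\<close>. The factor
  \<open>exp (z i)\<close> of the Taylor remainder cancels against the envelope, so no
  \<open>exp (2 * b)\<close> is lost; the Weierstrass product inequality adds up the
  coordinates.\<close>

lemma gauss_residual_diag:
  assumes b: "0 \<le> b" and x: "sqnorm d x \<le> 1"
  shows "gauss d b x x - gauss_low d b M x x \<le> real d * (2 * b) ^ M / fact M"
proof -
  define z where "z = (\<lambda>i. 2 * b * x i * x i)"
  define t where "t = (\<lambda>i. 1 - exp (- z i) * (\<Sum>k<M. z i ^ k / fact k))"
  have z: "0 \<le> z i" "z i \<le> 2 * b" if "i < d" for i
  proof -
    show "0 \<le> z i" using b by (simp add: z_def mult.assoc)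
    have "(x i)\<^sup>2 \<le> sqnorm d x" unfolding sqnorm_def using that by (intro member_le_sum) auto
    then have "2 * b * (x i)\<^sup>2 \<le> 2 * b * 1" using x b by (intro mult_left_mono) auto
    then show "z i \<le> 2 * b" by (simp add: z_def power2_eq_square)
  qed
  have t: "0 \<le> t i" "t i \<le> 1" "t i \<le> (2 * b) ^ M / fact M" if "i < d" for i
  proof -
    note e = exp_taylor_remainder_bounds[OF z(1)[OF that], of M]
    have "exp (- z i) * (\<Sum>k<M. z i ^ k / fact k) \<le> exp (- z i) * exp (z i)"
      using e(1) by (intro mult_left_mono) auto
    then show "0 \<le> t i" by (simp add: t_def flip: exp_add)
    show "t i \<le> 1" unfolding t_def using z(1)[OF that] by (simp add: sum_nonneg)
    have "t i = exp (- z i) * (exp (z i) - (\<Sum>k<M. z i ^ k / fact k))"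
      unfolding t_def by (simp add: right_diff_distrib flip: exp_add)
    also have "\<dots> \<le> exp (- z i) * (exp (z i) * z i ^ M / fact M)"
      using e(2) by (intro mult_left_mono) auto
    also have "\<dots> = z i ^ M / fact M" by (simp add: exp_minus)
    also have "\<dots> \<le> (2 * b) ^ M / fact M"
      using z[OF that] by (intro divide_right_mono power_mono) auto
    finally show "t i \<le> (2 * b) ^ M / fact M" .
  qed
  have "exp (- b * sqnorm d x) * exp (- b * sqnorm d x) = (\<Prod>i<d. exp (- z i))"
    unfolding exp_sum[OF finite_lessThan, symmetric] exp_add[symmetric]
    by (rule arg_cong[of _ _ exp]) (simp add: sqnorm_def z_def sum_distrib_left sum_negf power2_eq_square algebra_simps flip: sum.distrib)
  then have "gauss_low d b M x x = (\<Prod>i<d. 1 - t i)"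
    unfolding gauss_low_eq by (simp add: t_def z_def prod.distrib)
  also have "1 - (\<Sum>i<d. t i) \<le> (\<Prod>i<d. 1 - t i)"
    by (rule Weierstrass_prod_ineq) (use t in auto)
  moreover have "(\<Sum>i<d. t i) \<le> real d * ((2 * b) ^ M / fact M)"
    using sum_bounded_above[of "{..<d}" t "(2 * b) ^ M / fact M"] t(3) by simp
  moreover have "gauss d b x x = 1" by (simp add: gauss_def)
  ultimately show ?thesis by simp
qed

section \<open>Features independent of the Gaussian width\<close>

definition env_remainder :: "nat \<Rightarrow> real \<Rightarrow> nat \<Rightarrow> (nat \<Rightarrow> real) \<Rightarrow> real" where
  "env_remainder d b M x = exp (- b * sqnorm d x) - (\<Sum>k<M. (- b * sqnorm d x) ^ k / fact k)"

text \<open>For \<open>b \<le> 1\<close> the envelope \<open>exp (-b |x|\<^sup>2)\<close> is the sum of a Taylor polynomial \<open>p\<close> and a remainder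
  \<open>r\<close>. Since \<open>(p + r)\<^sup>2 \<le> 2 p\<^sup>2 + 2 r\<^sup>2\<close>, the \<open>p\<close> part is dominated by finitely many monomials that do not
  depend on \<open>b\<close>; \<open>gauss_high\<close> collects the rest. For \<open>b > 1\<close> the whole kernel counts as residual.\<close>

definition gauss_high :: "nat \<Rightarrow> real \<Rightarrow> nat \<Rightarrow> (nat \<Rightarrow> real) \<Rightarrow> (nat \<Rightarrow> real) \<Rightarrow> real" where
  "gauss_high d b M x y =
    (if b \<le> 1 then (gauss d b x y - gauss_low d b M x y) + 2 * (\<Sum>\<alpha>\<in>exponent_box d M. taylor_coeff d b \<alpha> *
       ((env_remainder d b M x * monom_at d \<alpha> x) * (env_remainder d b M y * monom_at d \<alpha> y)))
     else gauss d b x y)"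

lemma psd_gauss_high:
  assumes "0 \<le> b" shows "psd n (\<lambda>i j. gauss_high d b M (X i) (X j))"
proof (cases "b \<le> 1")
  case True
  have "psd n (\<lambda>i j. \<Sum>\<alpha>\<in>exponent_box d M. taylor_coeff d b \<alpha> *
       ((env_remainder d b M (X i) * monom_at d \<alpha> (X i)) * (env_remainder d b M (X j) * monom_at d \<alpha> (X j))))"
    unfolding psd_def qform_sum qform_cmult qform_rank_one
    by (auto intro!: sum_nonneg mult_nonneg_nonneg taylor_coeff_nonneg assms sum.cong)
  from psd_add[OF psd_gauss_residual[OF assms] psd_cmult[OF this, of 2]] show ?thesis
    using True by (simp add: gauss_high_def)
next
  case False
  then show ?thesis using psd_gauss[OF assms] by (simp add: gauss_high_def)
qed

lemma monom_at_sq_le: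
  assumes "sqnorm d x \<le> 1" shows "(monom_at d \<alpha> x)\<^sup>2 \<le> 1"
proof -
  have "\<bar>x i\<bar> \<le> 1" if "i < d" for i
  proof -
    have "(x i)\<^sup>2 \<le> sqnorm d x" unfolding sqnorm_def using that by (intro member_le_sum) auto
    then have "(x i)\<^sup>2 \<le> 1" using assms by linarith
    then show ?thesis by (simp add: abs_square_le_1)
  qed
  then have "\<bar>monom_at d \<alpha> x\<bar> \<le> 1"
    unfolding monom_at_def abs_prod power_abs by (intro prod_le_1) (auto simp: power_le_one)
  then show ?thesis by (simp add: abs_square_le_1)
qed

lemma sqnorm_nonneg: "0 \<le> sqnorm d x"
  by (simp add: sqnorm_def sum_nonneg)

text \<open>\<open>real d * 2 ^ M\<close> comes from truncating the monomial series. In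
  \<open>2 * exp 4\<close>, one \<open>exp 2\<close> stems from the squared envelope remainder, the
  other from the monomial sum without envelope, and the 2 from the definition. For
  \<open>b > 1\<close> the left side is 1.\<close>

lemma gauss_high_diag:
  assumes b: "0 \<le> b" and x: "sqnorm d x \<le> 1"
  shows "gauss_high d b M x x \<le> (real d * 2 ^ M + 2 * exp 4) * (min 1 b) ^ M"
proof (cases "b \<le> 1")
  case True
  have "gauss d b x x - gauss_low d b M x x \<le> real d * (2 * b) ^ M / fact M"
    by (rule gauss_residual_diag[OF b x])
  also have "\<dots> \<le> real d * (2 * b) ^ M"
    using b by (intro divide_fact_le) auto
  finally have 1: "gauss d b x x - gauss_low d b M x x \<le> real d * 2 ^ M * b ^ M"
    by (simp add: power_mult_distrib)
  have "\<bar>env_remainder d b M x\<bar> \<le> exp \<bar>- b * sqnorm d x\<bar> * \<bar>- b * sqnorm d x\<bar> ^ M"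
    unfolding env_remainder_def by (rule exp_taylor_remainder_abs)
  also have "\<bar>- b * sqnorm d x\<bar> = b * sqnorm d x" using b sqnorm_nonneg by (simp add: abs_mult)
  also have "exp (b * sqnorm d x) * (b * sqnorm d x) ^ M \<le> exp 1 * b ^ M"
    using b x True sqnorm_nonneg[of d x]
    by (intro mult_mono power_mono) (auto simp: mult_le_one mult_left_le)
  finally have "(env_remainder d b M x)\<^sup>2 \<le> (exp 1 * b ^ M)\<^sup>2"
    by (intro power2_le_iff_abs_le[THEN iffD2]) (auto simp: b)
  also have "\<dots> = exp 2 * (b ^ M * b ^ M)"
    by (simp add: power_mult_distrib power2_eq_square flip: exp_add)
  \<comment> \<open>One of the two powers is given up, so that both errors have order
    \<open>b ^ M\<close>.\<close>
  also have "\<dots> \<le> exp 2 * (b ^ M * 1)"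
    using b True by (intro mult_left_mono) (auto simp: power_le_one)
  finally have r: "(env_remainder d b M x)\<^sup>2 \<le> exp 2 * b ^ M" by simp
  \<comment> \<open>Dividing the envelope out of \<open>gauss_low\<close>, which is at most 1 on the
    diagonal, bounds the sum of the bare monomials.\<close>
  have "exp (- b * sqnorm d x) * exp (- b * sqnorm d x) * (\<Sum>\<alpha>\<in>exponent_box d M. taylor_coeff d b \<alpha> * (monom_at d \<alpha> x)\<^sup>2)
      = gauss_low d b M x x"
    unfolding gauss_low_def sum_distrib_left by (simp add: power2_eq_square algebra_simps)
  moreover have "gauss_low d b M x x \<le> 1" by (rule gauss_low_diag_le[OF b])
  ultimately have "(\<Sum>\<alpha>\<in>exponent_box d M. taylor_coeff d b \<alpha> * (monom_at d \<alpha> x)\<^sup>2) \<le> exp (b * sqnorm d x) * exp (b * sqnorm d x)"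
    by (simp add: exp_minus field_simps)
  also have "\<dots> \<le> exp 1 * exp 1"
    using b x True sqnorm_nonneg[of d x] by (intro mult_mono) (auto simp: mult_le_one)
  finally have s: "(\<Sum>\<alpha>\<in>exponent_box d M. taylor_coeff d b \<alpha> * (monom_at d \<alpha> x)\<^sup>2) \<le> exp 2"
    by (simp flip: exp_add)
  have "(\<Sum>\<alpha>\<in>exponent_box d M. taylor_coeff d b \<alpha> * ((env_remainder d b M x * monom_at d \<alpha> x) * (env_remainder d b M x * monom_at d \<alpha> x)))
      = (env_remainder d b M x)\<^sup>2 * (\<Sum>\<alpha>\<in>exponent_box d M. taylor_coeff d b \<alpha> * (monom_at d \<alpha> x)\<^sup>2)"
    unfolding sum_distrib_left by (simp add: power2_eq_square algebra_simps)
  also have "\<dots> \<le> (exp 2 * b ^ M) * exp 2"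
    using b by (intro mult_mono r s sum_nonneg mult_nonneg_nonneg taylor_coeff_nonneg) auto
  finally have "(\<Sum>\<alpha>\<in>exponent_box d M. taylor_coeff d b \<alpha> * ((env_remainder d b M x * monom_at d \<alpha> x) * (env_remainder d b M x * monom_at d \<alpha> x)))
     \<le> exp 4 * b ^ M" by (simp add: algebra_simps flip: exp_add)
  with 1 True show ?thesis unfolding gauss_high_def by (simp add: algebra_simps min_def)
next
  case False
  have "1 \<le> 2 * exp (4::real)" using one_le_exp_iff[of "4::real"] by linarith
  moreover have "0 \<le> real d * 2 ^ M" by simp
  ultimately have "1 \<le> real d * 2 ^ M + 2 * exp 4" by linarith
  then show ?thesis using False by (simp add: gauss_high_def gauss_def)
qed

text \<open>Neither the squares nor their factor depend on \<open>b\<close>, so the inequality can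
  be integrated over a mixture. The factor collects 2 from splitting the envelope, \<open>M\<close>
  from Cauchy-Schwarz over its Taylor terms, and \<open>2 ^ (d * M)\<close> from the coefficients at
  \<open>b \<le> 1\<close>.\<close>

lemma qform_gauss_le:
  assumes b: "0 \<le> b" 
  shows "qform n (\<lambda>i j. gauss d b (X i) (X j)) v
    \<le> real (2 * M * 2 ^ (d * M)) * (\<Sum>(k, \<alpha>)\<in>{..<M} \<times> exponent_box d M. (\<Sum>i<n. sqnorm d (X i) ^ k * monom_at d \<alpha> (X i) * v i)\<^sup>2)
      + qform n (\<lambda>i j. gauss_high d b M (X i) (X j)) v"
proof (cases "b \<le> 1")
  case False
  then show ?thesis by (simp add: gauss_high_def sum_nonneg case_prod_unfold)
next
  case True
  define P where "P = (\<lambda>k \<alpha>. \<Sum>i<n. sqnorm d (X i) ^ k * monom_at d \<alpha> (X i) * v i)"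
  define R where "R = (\<lambda>\<alpha>. \<Sum>i<n. env_remainder d b M (X i) * monom_at d \<alpha> (X i) * v i)"
  have c: "taylor_coeff d b \<alpha> \<le> 2 ^ (d * M)" if "\<alpha> \<in> exponent_box d M" for \<alpha>
  proof -
    have "taylor_coeff d b \<alpha> \<le> (\<Prod>i<d. 2 ^ M)"
      unfolding taylor_coeff_def
    proof (intro prod_mono conjI)
      fix i assume "i \<in> {..<d}"
      then have "\<alpha> i \<le> M" using that by (auto simp: exponent_box_def PiE_def Pi_def)
      have "(2 * b) ^ \<alpha> i / fact (\<alpha> i) \<le> (2 * b) ^ \<alpha> i" using b by (intro divide_fact_le) auto
      also have "\<dots> \<le> 2 ^ \<alpha> i" using b True by (intro power_mono) auto
      also have "\<dots> \<le> 2 ^ M" using \<open>\<alpha> i \<le> M\<close> by (intro power_increasing) auto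
      finally show "(2 * b) ^ \<alpha> i / fact (\<alpha> i) \<le> 2 ^ M" .
    qed (use b in auto)
    then show ?thesis by (simp add: power_mult mult.commute)
  qed
  have main: "(\<Sum>i<n. exp (- b * sqnorm d (X i)) * monom_at d \<alpha> (X i) * v i)\<^sup>2
      \<le> real (2 * M) * (\<Sum>k<M. (P k \<alpha>)\<^sup>2) + 2 * (R \<alpha>)\<^sup>2" for \<alpha>
  proof -
    have "(\<Sum>i<n. exp (- b * sqnorm d (X i)) * monom_at d \<alpha> (X i) * v i)
       = (\<Sum>i<n. (\<Sum>k<M. (- b * sqnorm d (X i)) ^ k / fact k) * monom_at d \<alpha> (X i) * v i) + R \<alpha>"
      unfolding R_def env_remainder_def sum.distrib[symmetric] by (simp add: algebra_simps)
    also have "(\<Sum>i<n. (\<Sum>k<M. (- b * sqnorm d (X i)) ^ k / fact k) * monom_at d \<alpha> (X i) * v i)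
       = (\<Sum>k<M. ((- b) ^ k / fact k) * P k \<alpha>)"
    proof -
      have "(- b * s) ^ k / fact k * m * w = (- b) ^ k / fact k * (s ^ k * m * w)" for s m w :: real and k
        by (simp only: power_mult_distrib) simp
      then show ?thesis unfolding P_def sum_distrib_left sum_distrib_right by (subst sum.swap) (simp only:)
    qed
    finally have e: "(\<Sum>i<n. exp (- b * sqnorm d (X i)) * monom_at d \<alpha> (X i) * v i)
       = (\<Sum>k<M. ((- b) ^ k / fact k) * P k \<alpha>) + R \<alpha>" .
    have "(\<Sum>k<M. ((- b) ^ k / fact k) * P k \<alpha>)\<^sup>2 \<le> (\<Sum>k<M. (((- b) ^ k / fact k) * P k \<alpha>)\<^sup>2) * real M"
      using sum_squared_le_sum_of_squares[of "\<lambda>k. ((- b) ^ k / fact k) * P k \<alpha>" "{..<M}"] by simp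
    also have "\<dots> \<le> (\<Sum>k<M. (P k \<alpha>)\<^sup>2) * real M"
    proof (intro mult_right_mono sum_mono)
      fix k
      have "\<bar>(- b) ^ k / fact k\<bar> = b ^ k / fact k" using b by (simp add: power_abs)
      also have "\<dots> \<le> b ^ k" using b by (intro divide_fact_le) auto
      also have "\<dots> \<le> 1" using b True by (rule power_le_one)
      finally have "((- b) ^ k / fact k)\<^sup>2 \<le> 1" by (simp only: abs_square_le_1)
      then have "((- b) ^ k / fact k)\<^sup>2 * (P k \<alpha>)\<^sup>2 \<le> 1 * (P k \<alpha>)\<^sup>2" by (rule mult_right_mono) simp
      then show "((- b) ^ k / fact k * P k \<alpha>)\<^sup>2 \<le> (P k \<alpha>)\<^sup>2" by (simp only: power_mult_distrib mult_1)
    qed simp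
    finally have p: "(\<Sum>k<M. ((- b) ^ k / fact k) * P k \<alpha>)\<^sup>2 \<le> real M * (\<Sum>k<M. (P k \<alpha>)\<^sup>2)" by (simp add: mult.commute)
    have "(p + q)\<^sup>2 \<le> 2 * p\<^sup>2 + 2 * q\<^sup>2" for p q :: real
      using zero_le_power2[of "p - q"] by (simp add: power2_eq_square algebra_simps)
    from this[of "\<Sum>k<M. ((- b) ^ k / fact k) * P k \<alpha>" "R \<alpha>"] p show ?thesis unfolding e by simp
  qed
  have "qform n (\<lambda>i j. gauss_low d b M (X i) (X j)) v
     \<le> (\<Sum>\<alpha>\<in>exponent_box d M. taylor_coeff d b \<alpha> * (real (2 * M) * (\<Sum>k<M. (P k \<alpha>)\<^sup>2) + 2 * (R \<alpha>)\<^sup>2))"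
    unfolding qform_gauss_low by (intro sum_mono mult_left_mono main taylor_coeff_nonneg b)
  also have "\<dots> = (\<Sum>\<alpha>\<in>exponent_box d M. taylor_coeff d b \<alpha> * (real (2 * M) * (\<Sum>k<M. (P k \<alpha>)\<^sup>2)))
      + 2 * (\<Sum>\<alpha>\<in>exponent_box d M. taylor_coeff d b \<alpha> * (R \<alpha>)\<^sup>2)"
    by (simp add: sum.distrib sum_distrib_left algebra_simps)
  also have "(\<Sum>\<alpha>\<in>exponent_box d M. taylor_coeff d b \<alpha> * (real (2 * M) * (\<Sum>k<M. (P k \<alpha>)\<^sup>2)))
     \<le> (\<Sum>\<alpha>\<in>exponent_box d M. 2 ^ (d * M) * (real (2 * M) * (\<Sum>k<M. (P k \<alpha>)\<^sup>2)))"
    by (intro sum_mono mult_right_mono c) (auto intro!: sum_nonneg mult_nonneg_nonneg)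
  also have "\<dots> = real (2 * M * 2 ^ (d * M)) * (\<Sum>\<alpha>\<in>exponent_box d M. \<Sum>k<M. (P k \<alpha>)\<^sup>2)"
    by (simp add: sum_distrib_left algebra_simps)
  also have "(\<Sum>\<alpha>\<in>exponent_box d M. \<Sum>k<M. (P k \<alpha>)\<^sup>2) = (\<Sum>(k, \<alpha>)\<in>{..<M} \<times> exponent_box d M. (P k \<alpha>)\<^sup>2)"
    by (subst sum.swap) (simp add: sum.cartesian_product)
  finally have low: "qform n (\<lambda>i j. gauss_low d b M (X i) (X j)) v \<le>
     real (2 * M * 2 ^ (d * M)) * (\<Sum>(k, \<alpha>)\<in>{..<M} \<times> exponent_box d M. (P k \<alpha>)\<^sup>2)
      + 2 * (\<Sum>\<alpha>\<in>exponent_box d M. taylor_coeff d b \<alpha> * (R \<alpha>)\<^sup>2)" by simp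
  have "qform n (\<lambda>i j. gauss d b (X i) (X j)) v
      = qform n (\<lambda>i j. (gauss d b (X i) (X j) - gauss_low d b M (X i) (X j)) + gauss_low d b M (X i) (X j)) v"
    by simp
  also have "\<dots> = qform n (\<lambda>i j. gauss d b (X i) (X j) - gauss_low d b M (X i) (X j)) v
      + qform n (\<lambda>i j. gauss_low d b M (X i) (X j)) v" by (rule qform_add)
  finally have g: "qform n (\<lambda>i j. gauss d b (X i) (X j)) v = \<dots>" .
  have "qform n (\<lambda>i j. gauss_high d b M (X i) (X j)) v
     = qform n (\<lambda>i j. gauss d b (X i) (X j) - gauss_low d b M (X i) (X j)) v
      + 2 * (\<Sum>\<alpha>\<in>exponent_box d M. taylor_coeff d b \<alpha> * (R \<alpha>)\<^sup>2)"
    using True unfolding gauss_high_def R_def by (simp only: if_True qform_add qform_cmult qform_sum qform_rank_one)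
  with g low show ?thesis unfolding P_def by linarith
qed

section \<open>The squared exponential kernel\<close>

lemma info_gain_eq:
  "info_gain k lam T xs = 1/2 * ln (detn T (\<lambda>i j. (if i = j then 1 else 0) + 1 / lam^2 * k (xs i) (xs j)))"
proof -
  have "1\<^sub>m T + (1 / lam^2) \<cdot>\<^sub>m gram k T xs
      = Matrix.mat T T (\<lambda>(i, j). (if i = j then 1 else 0) + 1 / lam^2 * k (xs i) (xs j))"
    unfolding gram_def by (rule eq_matI) auto
  then show ?thesis unfolding info_gain_def detn_def by simp
qed

lemma max_info_gain_le:
  assumes "\<And>xs. (\<And>i. i < T \<Longrightarrow> xs i \<in> unit_ball d) \<Longrightarrow> info_gain k lam T xs \<le> c"
  shows "max_info_gain k lam T (unit_ball d) \<le> c"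
  unfolding max_info_gain_def
proof (rule cSUP_least)
  \<comment> \<open>A uniform bound passes to a supremum of reals over a nonempty set; the origin
    supplies a configuration.\<close>
  have "(\<lambda>_. 0) \<in> unit_ball d" by (simp add: unit_ball_def ptnorm_def)
  then show "{xs. \<forall>i<T. xs i \<in> unit_ball d} \<noteq> {}" by auto
qed (use assms in auto)

lemma sqnorm_unit_ball: "x \<in> unit_ball d \<Longrightarrow> sqnorm d x \<le> 1"
  unfolding unit_ball_def ptnorm_def sqnorm_def by simp

lemma ptdist_sq: "(ptdist d x y)\<^sup>2 = (\<Sum>i<d. (x i - y i)\<^sup>2)"
  unfolding ptdist_def ptnorm_def by (simp add: sum_nonneg)

lemma k_SE_eq_gauss: "k_SE d l x y = gauss d (1 / (2 * l^2)) x y"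
  unfolding k_SE_def gauss_def ptdist_sq by simp

lemma gauss_low_term_le:
  assumes "0 \<le> b" "\<alpha> \<in> exponent_box d M"
  shows "taylor_coeff d b \<alpha> * (exp (- b * sqnorm d x) * monom_at d \<alpha> x)\<^sup>2 \<le> 1"
proof -
  have "taylor_coeff d b \<alpha> * (exp (- b * sqnorm d x) * monom_at d \<alpha> x)\<^sup>2 \<le> gauss_low d b M x x"
    unfolding gauss_low_def power2_eq_square
    by (rule member_le_sum[OF assms(2)]) (intro mult_nonneg_nonneg[OF taylor_coeff_nonneg zero_le_square] assms, simp)
  also have "\<dots> \<le> 1" by (rule gauss_low_diag_le[OF assms(1)])
  finally show ?thesis .
qed

text \<open>There are \<open>M ^ d\<close> features, and each has squared norm at most
  \<open>T / lam^2\<close> because its square is at most 1 at every point before scaling. The degree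
  \<open>M\<close> stays free, to be chosen by regime.\<close>

lemma info_gain_gauss_le:
  assumes b: "0 \<le> b" and xs: "\<And>i. i < T \<Longrightarrow> xs i \<in> unit_ball d"
  shows "info_gain (gauss d b) lam T xs
    \<le> 1/2 * (real (M ^ d) * ln (1 + real T / lam^2) + real T / lam^2 * (real d * (2 * b) ^ M / fact M))"
proof -
  define \<eta> where "\<eta> = 1 / lam^2"
  have \<eta>: "0 \<le> \<eta>" by (simp add: \<eta>_def)
  define f where "f = (\<lambda>\<alpha> i. sqrt (\<eta> * taylor_coeff d b \<alpha>) * (exp (- b * sqnorm d (xs i)) * monom_at d \<alpha> (xs i)))"
  define B where "B = (\<lambda>i j. \<eta> * (gauss d b (xs i) (xs j) - gauss_low d b M (xs i) (xs j)))"
  have sq: "(sqrt (\<eta> * taylor_coeff d b \<alpha>))\<^sup>2 = \<eta> * taylor_coeff d b \<alpha>" for \<alpha>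
    using \<eta> taylor_coeff_nonneg[OF b] by simp
  have "ln (detn T (\<lambda>i j. (if i = j then 1 else 0) + \<eta> * gauss d b (xs i) (xs j)))
     \<le> (\<Sum>\<alpha>\<in>exponent_box d M. ln (1 + (\<Sum>i<T. (f \<alpha> i)\<^sup>2))) + (\<Sum>i<T. B i i)"
  proof (rule ln_detn_le[where c = "\<lambda>_. 0 :: nat" and B = B and f = f])
    show "psd T (\<lambda>i j. \<eta> * gauss d b (xs i) (xs j))" by (intro psd_cmult psd_gauss b \<eta>)
    show "psd T B" unfolding B_def by (intro psd_cmult psd_gauss_residual b \<eta>)
    fix v
    have fv: "(\<Sum>i<T. f \<alpha> i * v i) = sqrt (\<eta> * taylor_coeff d b \<alpha>)
        * (\<Sum>i<T. exp (- b * sqnorm d (xs i)) * monom_at d \<alpha> (xs i) * v i)" for \<alpha>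
      unfolding f_def sum_distrib_left by (simp add: algebra_simps)
    have "(\<Sum>\<alpha>\<in>exponent_box d M. (\<Sum>i<T. f \<alpha> i * v i)\<^sup>2) = \<eta> * qform T (\<lambda>i j. gauss_low d b M (xs i) (xs j)) v"
      unfolding qform_gauss_low fv power_mult_distrib sq sum_distrib_left[where r = \<eta>]
      by (simp only: mult.assoc)
    then have "(\<Sum>\<alpha>\<in>exponent_box d M. (\<Sum>i<T. f \<alpha> i * v i)\<^sup>2) + qform T B v
       = qform T (\<lambda>i j. \<eta> * gauss_low d b M (xs i) (xs j) + B i j) v"
      by (simp add: qform_add qform_cmult)
    also have "\<dots> = qform T (\<lambda>i j. \<eta> * gauss d b (xs i) (xs j)) v"
      unfolding B_def by (simp add: algebra_simps)
    finally show "qform T (\<lambda>i j. if (0::nat) = 0 then \<eta> * gauss d b (xs i) (xs j) else 0) v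
       \<le> (\<Sum>\<alpha>\<in>exponent_box d M. (\<Sum>i<T. f \<alpha> i * v i)\<^sup>2) + qform T B v" by simp
  qed simp
  also have "\<dots> \<le> (\<Sum>\<alpha>\<in>exponent_box d M. ln (1 + real T * \<eta>)) + (\<Sum>i<T. \<eta> * (real d * (2 * b) ^ M / fact M))"
  proof (intro add_mono sum_mono)
    fix \<alpha> assume \<alpha>: "\<alpha> \<in> exponent_box d M"
    have "(f \<alpha> i)\<^sup>2 \<le> \<eta>" for i
    proof -
      have "(f \<alpha> i)\<^sup>2 = \<eta> * (taylor_coeff d b \<alpha> * (exp (- b * sqnorm d (xs i)) * monom_at d \<alpha> (xs i))\<^sup>2)"
        unfolding f_def power_mult_distrib[of "sqrt _"] sq by simp
      also have "\<dots> \<le> \<eta> * 1" by (intro mult_left_mono gauss_low_term_le[OF b \<alpha>] \<eta>)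
      finally show ?thesis by simp
    qed
    then have "(\<Sum>i<T. (f \<alpha> i)\<^sup>2) \<le> real T * \<eta>"
      using sum_bounded_above[of "{..<T}" "\<lambda>i. (f \<alpha> i)\<^sup>2" \<eta>] by simp
    then show "ln (1 + (\<Sum>i<T. (f \<alpha> i)\<^sup>2)) \<le> ln (1 + real T * \<eta>)"
      by (intro ln_mono) (auto intro!: add_pos_nonneg sum_nonneg)
  next
    fix i assume "i \<in> {..<T}"
    then show "B i i \<le> \<eta> * (real d * (2 * b) ^ M / fact M)"
      unfolding B_def by (intro mult_left_mono gauss_residual_diag b sqnorm_unit_ball xs \<eta>) auto
  qed
  also have "\<dots> = real (M ^ d) * ln (1 + real T / lam^2) + real T / lam^2 * (real d * (2 * b) ^ M / fact M)"
    by (simp add: card_exponent_box \<eta>_def)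
  finally show ?thesis unfolding info_gain_eq \<eta>_def by simp
qed

lemma max_info_gain_SE_le:
  assumes "0 < l"
  shows "max_info_gain (k_SE d l) lam T (unit_ball d)
    \<le> 1/2 * (real M ^ d * ln (1 + real T / lam^2) + real T / lam^2 * (real d * (2 / (2 * l^2)) ^ M / fact M))"
proof (rule max_info_gain_le)
  fix xs assume "\<And>i. i < T \<Longrightarrow> xs i \<in> unit_ball d"
  then show "info_gain (k_SE d l) lam T xs \<le> 1/2 * (real M ^ d * ln (1 + real T / lam^2) + real T / lam^2 * (real d * (2 / (2 * l^2)) ^ M / fact M))"
    using info_gain_gauss_le[of "1 / (2 * l^2)" T xs d lam M] by (simp add: k_SE_eq_gauss info_gain_eq)
qed

section \<open>Choice of the degree for the squared exponential kernel\<close>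

lemma power_add_one_le:
  fixes a :: real assumes "0 \<le> a" shows "(a + 1) ^ d \<le> 2 ^ d * (a ^ d + 1)"
proof -
  have "(a + 1) ^ d \<le> (2 * max a 1) ^ d" using assms by (intro power_mono) auto
  also have "\<dots> = 2 ^ d * (max a 1) ^ d" by (rule power_mult_distrib)
  also have "(max a 1) ^ d \<le> a ^ d + 1" using assms by (auto simp: max_def)
  finally show ?thesis by simp
qed

text \<open>The crude Stirling bound \<open>fact M \<ge> (M / e) ^ M\<close>, read off a single term
  of the exponential series.\<close>

lemma power_le_exp_mult_fact: "(real M) ^ M \<le> exp (real M) * fact M"
proof -
  have "real M ^ M / fact M \<le> (\<Sum>k<Suc M. real M ^ k / fact k)"
    by (rule member_le_sum) auto
  also have "\<dots> \<le> exp (real M)" by (rule exp_taylor_remainder_bounds) simp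
  finally show ?thesis by (simp add: field_simps)
qed

text \<open>The lower bound on \<open>T\<close> gives \<open>L \<ge> 1\<close>, and \<open>K\<close>
  bounds \<open>2 * l^2\<close> from above. Hence the rounding of \<open>M\<close> and the trace of
  the residual are both absorbed into the leading term.\<close>

lemma SE_small_lengthscale:
  fixes d :: nat and K :: real
  assumes d: "d \<ge> 1" and K: "0 < K"
  shows "\<exists>C1>0. \<forall>lam T l. 0 < lam \<longrightarrow> 0 < l \<longrightarrow> 2 * l^2 \<le> K \<longrightarrow> lam^2 \<le> real T / (exp 1 - 1) \<longrightarrow>
    max_info_gain (k_SE d l) lam T (unit_ball d) \<le> C1 / (2 * l^2) ^ d * ln (1 + real T / lam^2) ^ (d + 1)"
proof -
  \<comment> \<open>The summand \<open>2 * exp 2\<close> makes the tail decay like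
    \<open>exp (- M)\<close>; the summand \<open>K\<close> ensures \<open>M \<ge> L\<close>.\<close>
  define A where "A = 2 * exp 2 + K"
  have A: "2 * exp 2 \<le> A" "K \<le> A" "0 < A" using K by (auto simp: A_def add_pos_pos)
  \<comment> \<open>The \<open>K\<close> next to \<open>A\<close> pays for rounding \<open>M\<close>
    up, and \<open>real d * K ^ d\<close> pays for the trace.\<close>
  define C1 where "C1 = (A + K) ^ d + real d * K ^ d"
  have C1: "0 < C1" unfolding C1_def using A K by (intro add_pos_nonneg) auto
  have "max_info_gain (k_SE d l) lam T (unit_ball d) \<le> C1 / (2 * l^2) ^ d * ln (1 + real T / lam^2) ^ (d + 1)"
    if lam: "0 < lam" and l: "0 < l" and th: "2 * l^2 \<le> K" and T: "lam^2 \<le> real T / (exp 1 - 1)" for lam T l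
  proof -
    define \<theta> where "\<theta> = 2 * l^2"
    have \<theta>: "0 < \<theta>" "\<theta> \<le> K" using l th by (auto simp: \<theta>_def)
    define Y where "Y = real T / lam^2"
    define L where "L = ln (1 + Y)"
    have "exp 1 - 1 > (0::real)" by simp
    then have "exp 1 - 1 \<le> Y" using T lam by (simp add: Y_def field_simps)
    then have Y: "exp 1 \<le> 1 + Y" by simp
    have Y1: "0 < 1 + Y" using Y exp_gt_zero[of "1::real"] by linarith
    have L: "1 \<le> L" unfolding L_def using Y Y1 by (simp add: ln_ge_iff)
    have eL: "exp L = 1 + Y" using Y1 by (simp add: L_def)
    define M where "M = nat \<lceil>A * L / \<theta>\<rceil>"
    have ALp: "0 < A * L / \<theta>" using A L \<theta> by simp
    have M1: "A * L / \<theta> \<le> real M" unfolding M_def by (rule real_nat_ceiling_ge)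
    have M2: "real M \<le> A * L / \<theta> + 1" using ALp unfolding M_def by linarith
    have Mpos: "0 < real M" using M1 ALp by linarith
    have KL: "1 \<le> K / \<theta>" "1 \<le> K * L / \<theta>" using \<theta> L K mult_mono[of \<theta> K 1 L] by (auto simp: field_simps)
    \<comment> \<open>By Stirling the left side is at most
      \<open>(2 * e / (\<theta> * M)) ^ M\<close>, with base at most \<open>1 / e\<close> because
      \<open>\<theta> * M \<ge> A * L \<ge> 2 * e^2\<close>.\<close>
    have "(2 / \<theta>) ^ M / fact M \<le> exp (- L)"
    proof -
      have "1 / fact M \<le> exp (real M) / real M ^ M"
        using power_le_exp_mult_fact[of M] Mpos by (simp add: divide_le_eq le_divide_eq mult.commute)
      then have "(2 / \<theta>) ^ M * (1 / fact M) \<le> (2 / \<theta>) ^ M * (exp (real M) / real M ^ M)"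
        using \<theta> by (intro mult_left_mono) auto
      then have "(2 / \<theta>) ^ M / fact M \<le> exp (real M) * (2 / \<theta>) ^ M / real M ^ M"
        by (simp add: mult.commute)
      also have "\<dots> = (exp 1 * (2 / \<theta>) / real M) ^ M"
        by (simp add: power_divide power_mult_distrib exp_of_nat_mult[symmetric])
      also have "\<dots> \<le> exp (- 1) ^ M"
      proof (rule power_mono)
        have "2 * exp 2 * 1 \<le> A * L" using A L by (intro mult_mono) auto
        also have "A * L \<le> \<theta> * real M" using M1 \<theta> by (simp add: field_simps)
        finally have "exp 1 * (2 * exp 1) \<le> \<theta> * real M"
          using exp_add[of 1 "1 :: real"] by simp
        then show "exp 1 * (2 / \<theta>) / real M \<le> exp (- 1)"
          using Mpos \<theta> by (simp add: exp_minus field_simps)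
      qed (use \<theta> in auto)
      also have "\<dots> = exp (- real M)" by (simp flip: exp_of_nat_mult)
      also have "\<dots> \<le> exp (- L)"
      proof -
        have "\<theta> * L \<le> A * L" using \<theta> A L by (intro mult_right_mono) auto
        then have "L \<le> A * L / \<theta>" using \<theta> by (simp add: field_simps)
        then show ?thesis using M1 by simp
      qed
      finally show ?thesis .
    qed
    then have "Y * (real d * ((2 / \<theta>) ^ M / fact M)) \<le> Y * (real d * exp (- L))"
      using Y by (intro mult_left_mono) (auto simp: Y_def)
    also have "\<dots> = real d * (Y / (1 + Y))" by (simp add: exp_minus eL field_simps)
    also have "\<dots> \<le> real d * 1" using Y1 by (intro mult_left_mono) auto
    finally have tail: "Y * (real d * (2 / \<theta>) ^ M / fact M) \<le> real d" by simp
    have "real M \<le> (A + K) * L / \<theta>" using M2 KL(2) by (simp add: add_divide_distrib algebra_simps)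
    then have "real M ^ d \<le> ((A + K) * L / \<theta>) ^ d" by (intro power_mono) auto
    then have "real M ^ d * L \<le> ((A + K) * L / \<theta>) ^ d * L" using L by (intro mult_right_mono) auto
    also have "\<dots> = (A + K) ^ d / \<theta> ^ d * L ^ (d + 1)" by (simp add: power_divide power_mult_distrib)
    finally have 1: "real M ^ d * L \<le> (A + K) ^ d / \<theta> ^ d * L ^ (d + 1)" .
    have "real d * 1 * 1 \<le> real d * (K / \<theta>) ^ d * L ^ (d + 1)"
      using KL L by (intro mult_mono one_le_power) auto
    then have 2: "real d \<le> real d * K ^ d / \<theta> ^ d * L ^ (d + 1)" by (simp add: power_divide)
    have "max_info_gain (k_SE d l) lam T (unit_ball d)
       \<le> 1/2 * (real M ^ d * L + Y * (real d * (2 / \<theta>) ^ M / fact M))"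
      using max_info_gain_SE_le[OF l] unfolding Y_def L_def \<theta>_def .
    also have "\<dots> \<le> real M ^ d * L + real d"
    proof -
      have "0 \<le> real M ^ d * L" using L by simp
      then show ?thesis using tail by (simp add: field_simps)
    qed
    also have "\<dots> \<le> C1 / \<theta> ^ d * L ^ (d + 1)"
      using 1 2 by (simp add: C1_def add_divide_distrib ring_distribs)
    finally show ?thesis unfolding \<theta>_def L_def Y_def .
  qed
  with C1 show ?thesis by blast
qed

text \<open>For wide kernels \<open>2 / \<theta>\<close> is below 1 and its powers alone decay fast
  enough, so the factorial is dropped. \<open>L\<close> may be arbitrarily small here; rounding the
  degree therefore leaves its own term \<open>2 ^ d * L\<close>, and the trace leaves
  \<open>d\<close>.\<close>

lemma SE_large_lengthscale:
  assumes d: "d \<ge> 1" and lam: "0 < lam" and l: "0 < l" and T: "T \<ge> 1"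
    and cd: "1 \<le> cd" and th: "(exp 1)^2 * cd < 2 * l^2"
  defines "L \<equiv> ln (1 + real T / lam^2)"
  shows "max_info_gain (k_SE d l) lam T (unit_ball d)
    \<le> 2 ^ d / ln (2 * l^2 / (exp 1 * cd)) ^ d * L ^ (d + 1) + 2 ^ d * L + real d"
proof -
  define \<theta> where "\<theta> = 2 * l^2"
  define q where "q = ln (\<theta> / (exp 1 * cd))"
  define Y where "Y = real T / lam^2"
  have \<theta>: "0 < \<theta>" "exp 1 * (exp 1 * cd) < \<theta>" using l th by (auto simp: \<theta>_def power2_eq_square mult.assoc)
  have ec: "0 < exp 1 * cd" using cd by simp
  have eq: "exp q = \<theta> / (exp 1 * cd)" using \<theta> ec by (simp add: q_def)
  have q: "1 \<le> q"
  proof -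
    have "exp 1 \<le> exp q" unfolding eq using \<theta> ec by (simp add: field_simps)
    then show ?thesis by simp
  qed
  have Y: "0 < Y" using T lam by (simp add: Y_def)
  have Leq: "L = ln (1 + Y)" by (simp add: L_def Y_def)
  have L: "0 < L" using Y by (simp add: Leq)
  have eL: "exp L = 1 + Y" using Y by (simp add: Leq)
  \<comment> \<open>The smallest degree with \<open>q * M \<ge> L\<close>, so that the tail
    \<open>exp (- q * M)\<close> compensates \<open>1 + Y = exp L\<close>.\<close>
  define M where "M = nat \<lceil>L / q\<rceil>"
  have M1: "L / q \<le> real M" unfolding M_def by (rule real_nat_ceiling_ge)
  have M2: "real M \<le> L / q + 1" unfolding M_def using L q by (simp add: ceiling_correct of_nat_ceiling) 
  have e2: "(2::real) \<le> exp 1" using exp_ge_add_one_self[of 1] by simp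
  have "2 / \<theta> \<le> exp (- q)"
  proof -
    have "2 * 1 \<le> exp 1 * cd" using e2 cd by (intro mult_mono) auto
    then show ?thesis using \<theta> ec by (simp add: exp_minus eq field_simps)
  qed
  then have "(2 / \<theta>) ^ M \<le> exp (- q) ^ M" using \<theta> by (intro power_mono) auto
  also have "\<dots> = exp (- (q * real M))" by (simp add: mult.commute flip: exp_of_nat_mult)
  also have "\<dots> \<le> exp (- L)" using M1 q by (simp add: field_simps)
  finally have "(2 / \<theta>) ^ M / fact M \<le> exp (- L)"
    using divide_fact_le[of "(2 / \<theta>) ^ M" M] \<theta> by fastforce
  then have "Y * (real d * ((2 / \<theta>) ^ M / fact M)) \<le> Y * (real d * exp (- L))"
    using Y by (intro mult_left_mono) auto
  also have "\<dots> = real d * (Y / (1 + Y))" by (simp add: exp_minus eL field_simps)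
  also have "\<dots> \<le> real d * 1" using Y by (intro mult_left_mono) auto
  finally have tail: "Y * (real d * (2 / \<theta>) ^ M / fact M) \<le> real d" by simp
  have "real M ^ d \<le> (L / q + 1) ^ d" using M2 by (intro power_mono) auto
  also have "\<dots> \<le> 2 ^ d * ((L / q) ^ d + 1)" using L q by (intro power_add_one_le) auto
  finally have "real M ^ d * L \<le> 2 ^ d * ((L / q) ^ d + 1) * L" using L by (intro mult_right_mono) auto
  also have "\<dots> = 2 ^ d / q ^ d * L ^ (d + 1) + 2 ^ d * L"
    by (simp add: power_divide algebra_simps)
  finally have 1: "real M ^ d * L \<le> 2 ^ d / q ^ d * L ^ (d + 1) + 2 ^ d * L" .
  have "max_info_gain (k_SE d l) lam T (unit_ball d)
     \<le> 1/2 * (real M ^ d * L + Y * (real d * (2 / \<theta>) ^ M / fact M))"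
    using max_info_gain_SE_le[OF l] unfolding Y_def L_def \<theta>_def .
  also have "\<dots> \<le> real M ^ d * L + real d"
  proof -
    have "0 \<le> real M ^ d * L" using L by simp
    then show ?thesis using tail by (simp add: field_simps)
  qed
  finally show ?thesis using 1 unfolding q_def \<theta>_def by simp
qed

section \<open>The Matern kernel as a mixture of Gaussians\<close>

text \<open>The Gamma integrand in the logarithmic variable \<open>t\<close> with
  \<open>u = exp t / 2\<close>, up to the factor \<open>2 powr nu\<close>. On this scale a rescaling
  of the kernel is a translation.\<close>

definition gumbel_weight :: "real \<Rightarrow> real \<Rightarrow> real" where
  "gumbel_weight nu t = exp (nu * t - exp t / 2)"

lemma gumbel_weight_measurable [measurable]: "gumbel_weight nu \<in> borel_measurable borel"
  unfolding gumbel_weight_def by measurable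

lemma gumbel_weight_integral:
  assumes nu: "nu > 0"
  shows "integrable lborel (gumbel_weight nu)"
    and "(\<integral>t. gumbel_weight nu t \<partial>lborel) = 2 powr nu * Gamma nu"
proof -
  define g :: "real \<Rightarrow> real" where "g = (\<lambda>t. exp t / 2)"
  define f :: "real \<Rightarrow> real" where "f = (\<lambda>u. u powr (nu - 1) / exp u)"
  have img: "g ` UNIV = {0<..}"
  proof
    show "{0<..} \<subseteq> g ` UNIV"
    proof
      fix u :: real assume "u \<in> {0<..}"
      then have "u = g (ln (2 * u))" by (simp add: g_def)
      then show "u \<in> g ` UNIV" by blast
    qed
  qed (auto simp: g_def)
  have fi: "(f has_integral Gamma nu) {0<..}" 
  proof -
    have "((\<lambda>u. if u \<in> {0<..} then f u else 0) has_integral Gamma nu) {0..}"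
      by (rule has_integral_spike[of "{0}", rotated 2, OF Gamma_integral_real[OF nu, folded f_def]]) auto
    then show ?thesis by (subst (asm) has_integral_restrict) auto
  qed
  then have "f absolutely_integrable_on {0<..}"
    by (intro nonnegative_absolutely_integrable_1) (auto simp: f_def)
  then have "f absolutely_integrable_on (g ` UNIV) \<and> integral (g ` UNIV) f = Gamma nu"
    using fi img by (simp add: integral_unique)
  then have *: "(\<lambda>x. \<bar>exp x / 2\<bar> * f (g x)) absolutely_integrable_on UNIV
      \<and> integral UNIV (\<lambda>x. \<bar>exp x / 2\<bar> * f (g x)) = Gamma nu"
    by (subst has_absolute_integral_change_of_variables_1'[of UNIV g "\<lambda>x. exp x / 2" f])
       (auto simp: g_def inj_on_def intro!: derivative_eq_intros)
  have eq: "\<bar>exp x / 2\<bar> * f (g x) = 2 powr (- nu) * gumbel_weight nu x" for x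
  proof -
    have "exp x / 2 * (exp x / 2) powr (nu - 1) = (exp x / 2) powr nu"
      using powr_mult_base[of "exp x / 2" "nu - 1"] by simp
    also have "\<dots> = exp (nu * x) * 2 powr (- nu)"
    proof -
      have "(exp x / 2) powr nu = exp x powr nu / 2 powr nu" by (rule powr_divide)
      moreover have "exp x powr nu = exp (nu * x)" by (simp add: powr_def)
      moreover have "2 powr (- nu) = 1 / 2 powr nu" by (rule powr_minus_divide)
      ultimately show ?thesis by simp
    qed
    finally show ?thesis
      unfolding f_def g_def gumbel_weight_def by (simp add: exp_diff)
  qed
  have "integrable lebesgue (\<lambda>x. 2 powr (- nu) * gumbel_weight nu x)"
    using * unfolding eq set_integrable_def by simp
  then have 1: "integrable lborel (\<lambda>x. 2 powr (- nu) * gumbel_weight nu x)"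
    by (subst (asm) integrable_completion) auto
  then show int: "integrable lborel (gumbel_weight nu)" by simp
  have "(\<integral>t. 2 powr (- nu) * gumbel_weight nu t \<partial>lborel) = integral UNIV (\<lambda>x. 2 powr (- nu) * gumbel_weight nu x)"
    by (rule integral_lborel[OF 1, symmetric])
  also have "\<dots> = Gamma nu" using * unfolding eq by simp
  finally show "(\<integral>t. gumbel_weight nu t \<partial>lborel) = 2 powr nu * Gamma nu"
    by (simp add: powr_minus field_simps)
qed

text \<open>Writing \<open>cosh\<close> through exponentials makes the integral range over the whole line; the
  translation \<open>t \<mapsto> t - ln z\<close> then turns the Bessel integral into a mixture of Gaussians in \<open>z\<close>.\<close>

lemma besselK_eq_mixture:
  assumes nu: "nu > 0" and z: "z > 0"
  shows "z powr nu * besselK nu z = 1/2 * (\<integral>t. gumbel_weight nu t * exp (- (z\<^sup>2 / 2) * exp (- t)) \<partial>lborel)"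
proof -
  define H where "H = (\<lambda>t. gumbel_weight nu t * exp (- (z\<^sup>2 / 2) * exp (- t)))"
  define F where "F = (\<lambda>t. exp (- z * cosh t + nu * t))"
  have Hm [measurable]: "H \<in> borel_measurable borel" unfolding H_def by measurable
  have Fm [measurable]: "F \<in> borel_measurable borel"
    unfolding F_def cosh_def by measurable
  have H: "integrable lborel H"
    by (rule Bochner_Integration.integrable_bound[OF gumbel_weight_integral(1)[OF nu]])
       (auto simp: H_def gumbel_weight_def mult_le_cancel_left1 mult_nonneg_nonneg intro!: AE_I2)
  have FH: "F t = z powr (- nu) * H (ln z + 1 * t)" for t
  proof -
    have "exp (ln z + t) / 2 + z\<^sup>2 / 2 * exp (- (ln z + t)) = z * cosh t"
      using z by (simp add: exp_add exp_minus exp_diff cosh_def field_simps power2_eq_square)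
    moreover have "z powr (- nu) = exp (- (nu * ln z))" using z by (simp add: powr_def)
    ultimately show ?thesis unfolding F_def H_def gumbel_weight_def
      by (simp add: algebra_simps flip: exp_add)
  qed
  have F: "integrable lborel F"
    unfolding FH by (intro integrable_mult_right lborel_integrable_real_affine H) auto
  have F': "integrable lborel (\<lambda>t. F (- t))"
    using lborel_integrable_real_affine[OF F, of "-1" 0] by simp
  have Fint: "(\<integral>t. F t \<partial>lborel) = z powr (- nu) * (\<integral>t. H t \<partial>lborel)"
    using lborel_integral_real_affine[of 1 H "ln z"] unfolding FH by simp
  have i1: "integrable lborel (\<lambda>t. indicator {0..} t * F t)"
    using F by (simp add: integrable_mult_indicator[where 'b = real, simplified])
  have i2: "integrable lborel (\<lambda>t. indicator {0..} t * F (- t))"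
    using F' by (simp add: integrable_mult_indicator[where 'b = real, simplified])
  have i3: "integrable lborel (\<lambda>t. indicator {..0} t * F t)"
    using F by (simp add: integrable_mult_indicator[where 'b = real, simplified])
  have e: "indicator {0..} t * (exp (- z * cosh t) * cosh (nu * t))
      = 1/2 * (indicator {0..} t * F t + indicator {0..} t * F (- t))" for t
    unfolding F_def cosh_def[of "nu * t"] exp_add by (simp add: algebra_simps)
  have "set_integrable lborel {0..} (\<lambda>t. exp (- z * cosh t) * cosh (nu * t))"
    unfolding set_integrable_def real_scaleR_def e by (intro integrable_mult_right Bochner_Integration.integrable_add i1 i2)
  then have "besselK nu z = (\<integral>t. indicator {0..} t * (exp (- z * cosh t) * cosh (nu * t)) \<partial>lborel)"
    unfolding besselK_def by (subst set_borel_integral_eq_integral(2)[symmetric]) (auto simp: set_lebesgue_integral_def)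
  also have "\<dots> = 1/2 * ((\<integral>t. indicator {0..} t * F t \<partial>lborel) + (\<integral>t. indicator {0..} t * F (- t) \<partial>lborel))"
    unfolding e using i1 i2 by simp
  also have "(\<integral>t. indicator {0..} t * F (- t) \<partial>lborel) = (\<integral>t. indicator {..0} t * F t \<partial>lborel)"
  proof -
    have "indicator {..0} (- t) = (indicator {0..} t :: real)" for t :: real by (simp add: indicator_def)
    then show ?thesis using lborel_integral_real_affine[of "-1" "\<lambda>t. indicator {..0} t * F t" 0] by simp
  qed
  also have "(\<integral>t. indicator {0..} t * F t \<partial>lborel) + (\<integral>t. indicator {..0} t * F t \<partial>lborel)
      = (\<integral>t. indicator {0..} t * F t + indicator {..0} t * F t \<partial>lborel)" using i1 i3 by simp
  also have "\<dots> = (\<integral>t. F t \<partial>lborel)"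
  proof (rule integral_cong_AE)
    \<comment> \<open>The two half-lines overlap at 0, a null set.\<close>
    show "AE t in lborel. indicator {0..} t * F t + indicator {..0} t * F t = F t"
      using AE_lborel_singleton[of "0::real"] by eventually_elim (auto simp: indicator_def)
  qed measurable
  finally have "besselK nu z = 1/2 * (z powr (- nu) * (\<integral>t. H t \<partial>lborel))" unfolding Fint .
  then show ?thesis using z unfolding H_def by (simp add: powr_minus field_simps)
qed

text \<open>The density of \<open>t\<close> when \<open>exp t / 2\<close> is Gamma distributed with shape \<open>nu\<close>.\<close>

definition matern_density :: "real \<Rightarrow> real \<Rightarrow> real" where
  "matern_density nu t = gumbel_weight nu t / (2 powr nu * Gamma nu)"

lemma matern_density_measurable [measurable]: "matern_density nu \<in> borel_measurable borel"
  unfolding matern_density_def by measurable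

lemma matern_density_nonneg: "nu > 0 \<Longrightarrow> 0 \<le> matern_density nu t"
  unfolding matern_density_def gumbel_weight_def by (simp add: Gamma_real_pos less_imp_le)

lemma matern_density_integral:
  assumes "nu > 0"
  shows "integrable lborel (matern_density nu)" "(\<integral>t. matern_density nu t \<partial>lborel) = 1"
  using gumbel_weight_integral[OF assms] Gamma_real_pos[OF assms] unfolding matern_density_def by auto

text \<open>Since \<open>z\<^sup>2 / 2 = nu * r\<^sup>2 / l\<^sup>2\<close>, the Bessel mixture is
  one of Gaussians in the distance \<open>r\<close>, and the prefactor of the kernel normalises the
  weight. At distance 0 all Gaussians equal 1 and the total mass is 1, which agrees with the value
  set in \<open>k_Matern\<close>.\<close>

lemma k_Matern_eq_mixture:
  assumes nu: "nu > 0" and l: "l > 0"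
  shows "k_Matern d nu l x y = (\<integral>t. matern_density nu t * gauss d (nu / l^2 * exp (- t)) x y \<partial>lborel)"
proof (cases "ptdist d x y = 0")
  case True
  then have "(\<Sum>i<d. (x i - y i)\<^sup>2) = 0" using ptdist_sq[of d x y] by simp
  then have "gauss d b x y = 1" for b unfolding gauss_def by simp
  then show ?thesis using True matern_density_integral(2)[OF nu] unfolding k_Matern_def by simp
next
  case False
  have "0 \<le> ptdist d x y" unfolding ptdist_def ptnorm_def by (simp add: sum_nonneg)
  then have r: "0 < ptdist d x y" using False by simp
  define z where "z = sqrt (2 * nu) * ptdist d x y / l"
  have z: "0 < z" using r nu l by (simp add: z_def)
  have z2: "z\<^sup>2 / 2 * c = nu / l\<^sup>2 * c * (\<Sum>i<d. (x i - y i)\<^sup>2)" for c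
    using nu unfolding z_def ptdist_sq[symmetric] by (simp add: power_divide power_mult_distrib)
  have "k_Matern d nu l x y = 2 powr (1 - nu) / Gamma nu * (z powr nu * besselK nu z)"
    using False unfolding k_Matern_def by (simp add: z_def Let_def)
  also have "\<dots> = 1 / (2 powr nu * Gamma nu) * (\<integral>t. gumbel_weight nu t * exp (- (z\<^sup>2 / 2) * exp (- t)) \<partial>lborel)"
    unfolding besselK_eq_mixture[OF nu z] by (simp add: powr_diff)
  also have "\<dots> = (\<integral>t. 1 / (2 powr nu * Gamma nu) * (gumbel_weight nu t * exp (- (z\<^sup>2 / 2) * exp (- t))) \<partial>lborel)"
    by simp
  also have "\<dots> = (\<integral>t. matern_density nu t * gauss d (nu / l^2 * exp (- t)) x y \<partial>lborel)"
    unfolding matern_density_def gauss_def using z2 by (simp add: algebra_simps)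
  finally show ?thesis .
qed

text \<open>With \<open>\<tau> = t - ln S\<close> the density is at most
  \<open>S powr nu * exp (nu * \<tau>)\<close> up to its normalisation, and
  \<open>M \<ge> 2 * nu\<close> turns the truncated power into decay, leaving
  \<open>exp (- nu * \<bar>\<tau>\<bar>)\<close>. This is the source of the exponent
  \<open>nu\<close> and of the choice of degree.\<close>

lemma matern_density_truncated_moment:
  assumes nu: "nu > 0" and S: "S > 0" and M: "2 * nu \<le> real M"
  shows "(\<integral>t. matern_density nu t * (min 1 (S * exp (- t))) ^ M \<partial>lborel) \<le> 2 * exp (1/2) * S powr nu"
proof -
  define \<kappa> where "\<kappa> = 2 powr nu * Gamma nu"
  have \<kappa>: "0 < \<kappa>" using Gamma_real_pos[OF nu] by (simp add: \<kappa>_def)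
  define c where "c = S powr nu * exp (1/2) / \<kappa>"
  have c: "0 \<le> c" using \<kappa> by (simp add: c_def)
  let ?w1 = "\<lambda>t. gumbel_weight nu (- ln S + 1 * t)" and ?w2 = "\<lambda>t. gumbel_weight nu (ln S + (- 1) * t)"
  have gw: "integrable lborel (gumbel_weight nu)" by (rule gumbel_weight_integral[OF nu])
  have w1: "integrable lborel ?w1" by (rule lborel_integrable_real_affine[OF gw]) simp
  have w2: "integrable lborel ?w2" by (rule lborel_integrable_real_affine[OF gw]) simp
  have W1: "(\<integral>t. ?w1 t \<partial>lborel) = \<kappa>"
    using lborel_integral_real_affine[of 1 "gumbel_weight nu" "- ln S"] gumbel_weight_integral(2)[OF nu] by (simp add: \<kappa>_def)
  have W2: "(\<integral>t. ?w2 t \<partial>lborel) = \<kappa>"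
    using lborel_integral_real_affine[of "-1" "gumbel_weight nu" "ln S"] gumbel_weight_integral(2)[OF nu] by (simp add: \<kappa>_def)
  have pt: "matern_density nu t * (min 1 (S * exp (- t))) ^ M \<le> c * (?w1 t + ?w2 t)" for t
  proof -
    define \<tau> where "\<tau> = t - ln S"
    \<comment> \<open>The two-sided exponential is compared with two reflected copies of
      \<open>gumbel_weight\<close>, whose integral is known; their mass then cancels the
      normalisation \<open>\<kappa>\<close>.\<close>
    have half: "exp s \<le> exp (1/2) * gumbel_weight nu (s / nu)" if "s \<le> 0" for s
    proof -
      have "exp (s / nu) \<le> 1" using that nu by (simp add: divide_nonpos_pos)
      then show ?thesis using nu unfolding gumbel_weight_def by (simp flip: exp_add)
    qed
    have "gumbel_weight nu t \<le> exp (nu * t)" unfolding gumbel_weight_def by simp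
    also have "nu * t = nu * ln S + nu * \<tau>" by (simp add: \<tau>_def algebra_simps)
    also have "exp (nu * ln S + nu * \<tau>) = S powr nu * exp (nu * \<tau>)" using S by (simp add: exp_add powr_def)
    finally have a: "gumbel_weight nu t \<le> S powr nu * exp (nu * \<tau>)" .
    have "exp (- \<tau>) = S * exp (- t)" using S by (simp add: \<tau>_def exp_diff exp_minus field_simps)
    then have m: "(min 1 (S * exp (- t))) ^ M = (min 1 (exp (- \<tau>))) ^ M" by simp
    have nn: "0 \<le> gumbel_weight nu s" for s by (simp add: gumbel_weight_def)
    have b: "exp (nu * \<tau>) * (min 1 (exp (- \<tau>))) ^ M \<le> exp (1/2) * (gumbel_weight nu \<tau> + gumbel_weight nu (- \<tau>))"
    proof (cases "\<tau> \<le> 0")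
      case True
      have "exp (nu * \<tau>) * (min 1 (exp (- \<tau>))) ^ M = exp (nu * \<tau>)" using True by simp
      also have "\<dots> \<le> exp (1/2) * gumbel_weight nu \<tau>" using half[of "nu * \<tau>"] True nu by (simp add: mult_nonneg_nonpos)
      also have "\<dots> \<le> exp (1/2) * (gumbel_weight nu \<tau> + gumbel_weight nu (- \<tau>))"
        using nn by (intro mult_left_mono) auto
      finally show ?thesis .
    next
      case False
      have "exp (nu * \<tau>) * (min 1 (exp (- \<tau>))) ^ M = exp (nu * \<tau>) * exp (- (real M * \<tau>))"
        using False by (simp add: min_def flip: exp_of_nat_mult)
      also have "\<dots> = exp (nu * \<tau> - real M * \<tau>)" by (simp add: exp_diff exp_minus divide_inverse)
      also have "\<dots> \<le> exp (- nu * \<tau>)"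
      proof -
        have "2 * nu * \<tau> \<le> real M * \<tau>" using M False by (intro mult_right_mono) auto
        then show ?thesis by (simp add: algebra_simps)
      qed
      also have "\<dots> \<le> exp (1/2) * gumbel_weight nu (- \<tau>)" using half[of "- nu * \<tau>"] False nu by simp
      also have "\<dots> \<le> exp (1/2) * (gumbel_weight nu \<tau> + gumbel_weight nu (- \<tau>))"
        using nn by (intro mult_left_mono) auto
      finally show ?thesis .
    qed
    have "matern_density nu t * (min 1 (S * exp (- t))) ^ M \<le> (S powr nu * exp (nu * \<tau>)) / \<kappa> * (min 1 (exp (- \<tau>))) ^ M"
      unfolding m matern_density_def \<kappa>_def[symmetric] using a \<kappa> by (intro mult_right_mono divide_right_mono) auto
    also have "\<dots> = S powr nu / \<kappa> * (exp (nu * \<tau>) * (min 1 (exp (- \<tau>))) ^ M)" by simp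
    also have "\<dots> \<le> S powr nu / \<kappa> * (exp (1/2) * (gumbel_weight nu \<tau> + gumbel_weight nu (- \<tau>)))"
      using b \<kappa> by (intro mult_left_mono) auto
    also have "\<dots> = c * (?w1 t + ?w2 t)" by (simp add: c_def \<tau>_def)
    finally show ?thesis .
  qed
  have "(\<integral>t. matern_density nu t * (min 1 (S * exp (- t))) ^ M \<partial>lborel) \<le> (\<integral>t. c * (?w1 t + ?w2 t) \<partial>lborel)"
  proof (rule integral_mono)
    show "integrable lborel (\<lambda>t. matern_density nu t * (min 1 (S * exp (- t))) ^ M)"
    proof (rule Bochner_Integration.integrable_bound[OF matern_density_integral(1)[OF nu]])
      have "\<bar>matern_density nu t * (min 1 (S * exp (- t))) ^ M\<bar> \<le> \<bar>matern_density nu t\<bar>" for t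
        using S by (simp add: abs_mult power_abs mult_left_le power_le_one)
      then show "AE t in lborel. norm (matern_density nu t * (min 1 (S * exp (- t))) ^ M) \<le> norm (matern_density nu t)"
        by (intro AE_I2) simp
    qed measurable
    show "integrable lborel (\<lambda>t. c * (?w1 t + ?w2 t))" using w1 w2 by simp
  qed (rule pt)
  also have "\<dots> = c * (\<kappa> + \<kappa>)" using w1 w2 W1 W2 by simp
  also have "\<dots> = 2 * exp (1/2) * S powr nu" using \<kappa> by (simp add: c_def)
  finally show ?thesis .
qed

section \<open>The Matern kernel\<close>

lemma qform_integral:
  assumes "\<And>i j. i < n \<Longrightarrow> j < n \<Longrightarrow> integrable N (\<lambda>t. w t * F t i j :: real)"
  shows "integrable N (\<lambda>t. w t * qform n (F t) v)"
    and "qform n (\<lambda>i j. \<integral>t. w t * F t i j \<partial>N) v = (\<integral>t. w t * qform n (F t) v \<partial>N)"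
proof -
  have e: "w t * qform n (F t) v = (\<Sum>i<n. \<Sum>j<n. (w t * F t i j) * (v i * v j))" for t
    unfolding qform_def sum_distrib_left by (intro sum.cong refl) (simp add: mult.assoc)
  have i: "integrable N (\<lambda>t. (w t * F t i j) * (v i * v j))" if "i < n" "j < n" for i j
    using assms[OF that] by (rule integrable_mult_left)
  show "integrable N (\<lambda>t. w t * qform n (F t) v)"
    unfolding e using i by (intro Bochner_Integration.integrable_sum) auto
  have "(\<integral>t. w t * qform n (F t) v \<partial>N) = (\<Sum>i<n. \<integral>t. (\<Sum>j<n. (w t * F t i j) * (v i * v j)) \<partial>N)"
    unfolding e using i by (intro Bochner_Integration.integral_sum Bochner_Integration.integrable_sum) auto
  also have "\<dots> = (\<Sum>i<n. \<Sum>j<n. \<integral>t. (w t * F t i j) * (v i * v j) \<partial>N)"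
    using i by (intro sum.cong refl Bochner_Integration.integral_sum) auto
  also have "\<dots> = qform n (\<lambda>i j. \<integral>t. w t * F t i j \<partial>N) v"
    unfolding qform_def
    by (intro sum.cong refl) (simp only: integral_mult_left_zero mult.assoc[of "integral\<^sup>L _ _"])
  finally show "qform n (\<lambda>i j. \<integral>t. w t * F t i j \<partial>N) v = (\<integral>t. w t * qform n (F t) v \<partial>N)" ..
qed

lemma integrable_matern_density_mult:
  assumes "nu > 0" and [measurable]: "f \<in> borel_measurable borel" and "\<And>t. \<bar>f t\<bar> \<le> c"
  shows "integrable lborel (\<lambda>t. matern_density nu t * f t)"
proof (rule Bochner_Integration.integrable_bound[of _ "\<lambda>t. c * matern_density nu t"])
  show "integrable lborel (\<lambda>t. c * matern_density nu t)"
    using matern_density_integral(1)[OF assms(1)] by simp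
  have "norm (matern_density nu t * f t) \<le> norm (c * matern_density nu t)" for t
  proof -
    have "\<bar>matern_density nu t\<bar> * \<bar>f t\<bar> \<le> \<bar>matern_density nu t\<bar> * \<bar>c\<bar>"
      using assms(3)[of t] by (intro mult_left_mono) auto
    then show ?thesis by (simp add: abs_mult mult.commute)
  qed
  then show "AE t in lborel. norm (matern_density nu t * f t) \<le> norm (c * matern_density nu t)" by simp
qed measurable

lemma gauss_measurable [measurable (raw)]:
  assumes [measurable]: "f \<in> borel_measurable N" shows "(\<lambda>t. gauss d (f t) x y) \<in> borel_measurable N"
  unfolding gauss_def by measurable

lemma gauss_high_measurable [measurable (raw)]:
  assumes [measurable]: "f \<in> borel_measurable N" shows "(\<lambda>t. gauss_high d (f t) M x y) \<in> borel_measurable N"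
  unfolding gauss_high_def gauss_low_def env_remainder_def taylor_coeff_def by measurable

lemma gauss_abs_le: "0 \<le> b \<Longrightarrow> \<bar>gauss d b x y\<bar> \<le> 1"
  unfolding gauss_def by (simp add: sum_nonneg)

lemma gauss_high_sym:
  assumes "0 \<le> b" shows "gauss_high d b M x y = gauss_high d b M y x"
proof -
  let ?X = "\<lambda>i::nat. if i = 0 then x else y"
  have "\<forall>i<2. \<forall>j<2. gauss_high d b M (?X i) (?X j) = gauss_high d b M (?X j) (?X i)"
    using psd_gauss_high[OF assms, of 2 d M ?X] unfolding psd_def by (rule conjunct1)
  from this[rule_format, of 0 1] show ?thesis by simp
qed

text \<open>Positive semidefiniteness on the pair \<open>x\<close>, \<open>y\<close> reduces this to
  the diagonal. The bound is uniform in \<open>b\<close>, which makes the mixture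
  integrable.\<close>

lemma gauss_high_abs_le:
  assumes b: "0 \<le> b" and x: "sqnorm d x \<le> 1" and y: "sqnorm d y \<le> 1"
  shows "\<bar>gauss_high d b M x y\<bar> \<le> real d * 2 ^ M + 2 * exp 4"
proof -
  define c where "c = real d * 2 ^ M + 2 * exp 4"
  have c: "0 \<le> c" unfolding c_def by (intro add_nonneg_nonneg) auto
  have diag: "gauss_high d b M u u \<le> c" if "sqnorm d u \<le> 1" for u
  proof -
    have "gauss_high d b M u u \<le> c * (min 1 b) ^ M" unfolding c_def by (rule gauss_high_diag[OF b that])
    also have "\<dots> \<le> c * 1" using b c by (intro mult_left_mono power_le_one) auto
    finally show ?thesis by simp
  qed
  have "psd 2 (\<lambda>i j. gauss_high d b M (if i = 0 then x else y) (if j = 0 then x else y))"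
    using psd_gauss_high[OF b, of 2 d M "\<lambda>i. if i = 0 then x else y"] .
  from psd_offdiag_le[OF this] have "\<bar>gauss_high d b M x y\<bar> \<le> (gauss_high d b M x x + gauss_high d b M y y) / 2"
    by simp
  then show ?thesis using diag[OF x] diag[OF y] unfolding c_def by simp
qed

definition matern_high :: "nat \<Rightarrow> real \<Rightarrow> real \<Rightarrow> nat \<Rightarrow> (nat \<Rightarrow> real) \<Rightarrow> (nat \<Rightarrow> real) \<Rightarrow> real" where
  "matern_high d nu S M x y = (\<integral>t. matern_density nu t * gauss_high d (S * exp (- t)) M x y \<partial>lborel)"

context
  fixes d :: nat and nu S :: real
  assumes nu: "nu > 0" and S: "S > 0"
begin

lemma integrable_gauss_mixture:
  "integrable lborel (\<lambda>t. matern_density nu t * gauss d (S * exp (- t)) x y)"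
  by (rule integrable_matern_density_mult[OF nu, where c = 1]) (auto intro!: gauss_abs_le simp: S less_imp_le)

lemma integrable_gauss_high_mixture:
  assumes "sqnorm d x \<le> 1" "sqnorm d y \<le> 1"
  shows "integrable lborel (\<lambda>t. matern_density nu t * gauss_high d (S * exp (- t)) M x y)"
  by (rule integrable_matern_density_mult[OF nu, where c = "real d * 2 ^ M + 2 * exp 4"])
     (auto intro!: gauss_high_abs_le assms simp: S less_imp_le)

lemma psd_gauss_mixture:
  "psd n (\<lambda>i j. \<integral>t. matern_density nu t * gauss d (S * exp (- t)) (X i) (X j) \<partial>lborel)"
  unfolding psd_def
proof (intro conjI allI impI)
  fix v
  have "0 \<le> qform n (\<lambda>i j. gauss d (S * exp (- t)) (X i) (X j)) v" for t
    using psd_gauss[of "S * exp (- t)" n d X] S by (simp add: psd_def)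
  then show "0 \<le> qform n (\<lambda>i j. \<integral>t. matern_density nu t * gauss d (S * exp (- t)) (X i) (X j) \<partial>lborel) v"
    by (subst qform_integral[where F = "\<lambda>t i j. gauss d (S * exp (- t)) (X i) (X j)"])
       (auto intro!: integrable_gauss_mixture integral_nonneg_AE AE_I2 mult_nonneg_nonneg matern_density_nonneg nu)
next
  fix i j
  show "(\<integral>t. matern_density nu t * gauss d (S * exp (- t)) (X i) (X j) \<partial>lborel)
      = (\<integral>t. matern_density nu t * gauss d (S * exp (- t)) (X j) (X i) \<partial>lborel)"
    by (subst gauss_sym) (rule refl)
qed

lemma psd_matern_high:
  assumes X: "\<And>i. sqnorm d (X i) \<le> 1"
  shows "psd n (\<lambda>i j. matern_high d nu S M (X i) (X j))"
  unfolding psd_def matern_high_def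
proof (intro conjI allI impI)
  fix v
  have "0 \<le> qform n (\<lambda>i j. gauss_high d (S * exp (- t)) M (X i) (X j)) v" for t
    using psd_gauss_high[of "S * exp (- t)" n d M X] S by (simp add: psd_def)
  then show "0 \<le> qform n (\<lambda>i j. \<integral>t. matern_density nu t * gauss_high d (S * exp (- t)) M (X i) (X j) \<partial>lborel) v"
    by (subst qform_integral[where F = "\<lambda>t i j. gauss_high d (S * exp (- t)) M (X i) (X j)"])
       (auto intro!: integrable_gauss_high_mixture integral_nonneg_AE AE_I2 mult_nonneg_nonneg matern_density_nonneg nu X)
next
  fix i j
  show "(\<integral>t. matern_density nu t * gauss_high d (S * exp (- t)) M (X i) (X j) \<partial>lborel)
      = (\<integral>t. matern_density nu t * gauss_high d (S * exp (- t)) M (X j) (X i) \<partial>lborel)"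
    using S by (subst gauss_high_sym) auto
qed

lemma matern_high_diag:
  assumes x: "sqnorm d x \<le> 1" and M: "2 * nu \<le> real M"
  shows "matern_high d nu S M x x \<le> (real d * 2 ^ M + 2 * exp 4) * (2 * exp (1/2)) * S powr nu"
proof -
  let ?c = "real d * 2 ^ M + 2 * exp 4 :: real"
  have c: "0 \<le> ?c" by (intro add_nonneg_nonneg) auto
  have i: "integrable lborel (\<lambda>t. matern_density nu t * (?c * (min 1 (S * exp (- t))) ^ M))"
  proof (rule integrable_matern_density_mult[OF nu, where c = ?c])
    fix t
    have "\<bar>?c * (min 1 (S * exp (- t))) ^ M\<bar> = ?c * (min 1 (S * exp (- t))) ^ M"
      using c S by simp
    also have "\<dots> \<le> ?c * 1" using c S by (intro mult_left_mono power_le_one) auto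
    finally show "\<bar>?c * (min 1 (S * exp (- t))) ^ M\<bar> \<le> ?c" by simp
  qed measurable
  have "matern_high d nu S M x x \<le> (\<integral>t. matern_density nu t * (?c * (min 1 (S * exp (- t))) ^ M) \<partial>lborel)"
    unfolding matern_high_def using S
    by (intro integral_mono integrable_gauss_high_mixture x i mult_left_mono gauss_high_diag matern_density_nonneg nu) auto
  also have "\<dots> = ?c * (\<integral>t. matern_density nu t * (min 1 (S * exp (- t))) ^ M \<partial>lborel)"
    by (simp add: mult.left_commute[of "matern_density nu _"])
  also have "\<dots> \<le> ?c * (2 * exp (1/2) * S powr nu)"
    by (intro mult_left_mono matern_density_truncated_moment nu S M c)
  finally show ?thesis by (simp add: mult.assoc)
qed

lemma qform_gauss_mixture_le:
  assumes X: "\<And>i. sqnorm d (X i) \<le> 1"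
  shows "qform n (\<lambda>i j. \<integral>t. matern_density nu t * gauss d (S * exp (- t)) (X i) (X j) \<partial>lborel) v
    \<le> real (2 * M * 2 ^ (d * M)) * (\<Sum>(k, \<alpha>)\<in>{..<M} \<times> exponent_box d M. (\<Sum>i<n. sqnorm d (X i) ^ k * monom_at d \<alpha> (X i) * v i)\<^sup>2)
      + qform n (\<lambda>i j. matern_high d nu S M (X i) (X j)) v"
proof -
  define P where "P = real (2 * M * 2 ^ (d * M)) * (\<Sum>(k, \<alpha>)\<in>{..<M} \<times> exponent_box d M. (\<Sum>i<n. sqnorm d (X i) ^ k * monom_at d \<alpha> (X i) * v i)\<^sup>2)"
  let ?g = "\<lambda>t i j. gauss d (S * exp (- t)) (X i) (X j)" and ?h = "\<lambda>t i j. gauss_high d (S * exp (- t)) M (X i) (X j)"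
  note g = qform_integral[where w = "matern_density nu" and F = ?g and v = v and n = n, OF integrable_gauss_mixture]
  note h = qform_integral[where w = "matern_density nu" and F = ?h and v = v and n = n, OF integrable_gauss_high_mixture[OF X X]]
  note w = matern_density_integral[OF nu]
  have "qform n (\<lambda>i j. \<integral>t. matern_density nu t * ?g t i j \<partial>lborel) v = (\<integral>t. matern_density nu t * qform n (?g t) v \<partial>lborel)"
    by (rule g(2))
  also have "\<dots> \<le> (\<integral>t. matern_density nu t * P + matern_density nu t * qform n (?h t) v \<partial>lborel)"
  proof (rule integral_mono[OF g(1)])
    show "integrable lborel (\<lambda>t. matern_density nu t * P + matern_density nu t * qform n (?h t) v)"
      using w(1) h(1) by simp
    fix t
    have "qform n (?g t) v \<le> P + qform n (?h t) v"
      unfolding P_def using S by (intro qform_gauss_le) simp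
    then have "matern_density nu t * qform n (?g t) v \<le> matern_density nu t * (P + qform n (?h t) v)"
      by (intro mult_left_mono matern_density_nonneg nu)
    then show "matern_density nu t * qform n (?g t) v \<le> matern_density nu t * P + matern_density nu t * qform n (?h t) v"
      by (simp add: distrib_left)
  qed
  \<comment> \<open>\<open>P\<close> does not depend on \<open>t\<close>, and the density has mass
    1.\<close>
  also have "\<dots> = P + (\<integral>t. matern_density nu t * qform n (?h t) v \<partial>lborel)"
    using w h(1) by simp
  also have "(\<integral>t. matern_density nu t * qform n (?h t) v \<partial>lborel) = qform n (\<lambda>i j. matern_high d nu S M (X i) (X j)) v"
    unfolding matern_high_def by (rule h(2)[symmetric])
  finally show ?thesis unfolding P_def .
qed

end

text \<open>There are \<open>(2 * n + 1) ^ d\<close> cells with \<open>M * M ^ d\<close> features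
  each, one for every power of the squared norm and every exponent in the box. \<open>S\<close> is
  the rate \<open>nu / l^2\<close> of the Gaussians in the coordinates of a cell.\<close>

lemma info_gain_Matern_le:
  assumes nu: "nu > 0" and l: "l > 0" and n: "n \<ge> (1::nat)" and d: "d \<ge> 1" and M: "2 * nu \<le> real M"
    and xs: "\<And>i. i < T \<Longrightarrow> xs i \<in> unit_ball d"
  defines "S \<equiv> nu * real d / (real n * l)\<^sup>2"
  shows "info_gain (k_Matern d nu l) lam T xs
    \<le> 1/2 * (real ((2 * n + 1) ^ d * (M * M ^ d)) * ln (1 + real (2 * M * 2 ^ (d * M)) * (real T / lam^2))
         + real T / lam^2 * ((real d * 2 ^ M + 2 * exp 4) * (2 * exp (1/2)) * S powr nu))"
proof -
  define \<eta> where "\<eta> = 1 / lam^2"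
  have \<eta>: "0 \<le> \<eta>" by (simp add: \<eta>_def)
  define c where "c = real (2 * M * 2 ^ (d * M))"
  have c: "0 \<le> c" by (simp add: c_def)
  have S: "S > 0" unfolding S_def using nu l n d by simp
  \<comment> \<open>A coordinate equal to 1 has floor \<open>n\<close>, so each coordinate of a
    label takes values from \<open>- n\<close> to \<open>n\<close>. \<open>restrict\<close> places
    the labels in the finite product \<open>A\<close>.\<close>
  define cell where "cell = (\<lambda>i. restrict (\<lambda>k. \<lfloor>real n * xs i k\<rfloor>) {..<d})"
  \<comment> \<open>The position within the cell, divided by \<open>sqrt d\<close> so that the unit
    cube fits into the unit ball.\<close>
  define y where "y = (\<lambda>i k. frac (real n * xs i k) / sqrt (real d))"
  define A where "A = PiE {..<d} (\<lambda>_. {- int n..int n})"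
  have finA: "finite A" unfolding A_def by (intro finite_PiE) auto
  have cardA: "card A = (2 * n + 1) ^ d" unfolding A_def by (simp add: card_PiE nat_add_distrib nat_mult_distrib)
  have cellA: "cell ` {..<T} \<subseteq> A"
  proof
    fix q assume "q \<in> cell ` {..<T}"
    then obtain i where i: "i < T" "q = cell i" by auto
    have "\<lfloor>real n * xs i k\<rfloor> \<in> {- int n..int n}" if "k < d" for k
    proof -
      have "(xs i k)\<^sup>2 \<le> sqnorm d (xs i)" unfolding sqnorm_def using that by (intro member_le_sum) auto
      then have "(xs i k)\<^sup>2 \<le> 1" using sqnorm_unit_ball[OF xs[OF i(1)]] by linarith
      then have x: "- 1 \<le> xs i k" "xs i k \<le> 1" by (auto simp: abs_square_le_1 abs_le_iff)
      have "real n * (- 1) \<le> real n * xs i k" "real n * xs i k \<le> real n * 1"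
        using mult_left_mono[OF x(1), of "real n"] mult_left_mono[OF x(2), of "real n"] by auto
      then show ?thesis by (auto simp: le_floor_iff floor_le_iff)
    qed
    then show "q \<in> A" using i by (auto simp: A_def cell_def)
  qed
  have y1: "sqnorm d (y i) \<le> 1" for i
  proof -
    have "(y i k)\<^sup>2 \<le> 1 / real d" for k
    proof -
      have "(frac (real n * xs i k))\<^sup>2 \<le> 1"
        using frac_lt_1[of "real n * xs i k"] frac_ge_0[of "real n * xs i k"] by (simp add: abs_square_le_1 less_imp_le)
      then show ?thesis unfolding y_def by (simp add: power_divide divide_right_mono)
    qed
    then have "sqnorm d (y i) \<le> real (card {..<d}) * (1 / real d)"
      unfolding sqnorm_def by (intro sum_bounded_above) auto
    then show ?thesis using d by simp
  qed
  have same: "gauss d (nu / l\<^sup>2 * e) (xs i) (xs j) = gauss d (S * e) (y i) (y j)" if "cell i = cell j" for i j e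
  proof -
    have "(xs i k - xs j k)\<^sup>2 = real d / (real n)\<^sup>2 * (y i k - y j k)\<^sup>2" if "k < d" for k
    proof -
      have "\<lfloor>real n * xs i k\<rfloor> = \<lfloor>real n * xs j k\<rfloor>"
        using \<open>cell i = cell j\<close> that unfolding cell_def by (metis lessThan_iff restrict_apply)
      then have "real n * (xs i k - xs j k) = sqrt (real d) * (y i k - y j k)"
        using d unfolding y_def frac_def by (simp add: field_simps)
      then have "(real n)\<^sup>2 * (xs i k - xs j k)\<^sup>2 = real d * (y i k - y j k)\<^sup>2"
        by (metis of_nat_0_le_iff power_mult_distrib real_sqrt_pow2)
      then show ?thesis using n by (simp add: field_simps)
    qed
    then have "(\<Sum>k<d. (xs i k - xs j k)\<^sup>2) = real d / (real n)\<^sup>2 * (\<Sum>k<d. (y i k - y j k)\<^sup>2)"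
      unfolding sum_distrib_left by (intro sum.cong) auto
    then show ?thesis unfolding gauss_def S_def by (simp add: power_mult_distrib mult_ac)
  qed
  \<comment> \<open>\<open>mix\<close> sees positions within cells only and agrees with the kernel
    for points of one cell; the pinched form reads no other entries.\<close>
  define mix where "mix = (\<lambda>i j. \<integral>t. matern_density nu t * gauss d (S * exp (- t)) (y i) (y j) \<partial>lborel)"
  have kmix: "k_Matern d nu l (xs i) (xs j) = mix i j" if "cell i = cell j" for i j
    unfolding k_Matern_eq_mixture[OF nu l] mix_def same[OF that] ..
  define P where "P = (\<lambda>(k, \<alpha>) i. sqnorm d (y i) ^ k * monom_at d \<alpha> (y i))"
  define E where "E = {..<M} \<times> exponent_box d M"
  define J where "J = A \<times> E"
  define f where "f = (\<lambda>(q, e) i. sqrt (\<eta> * c) * (if cell i = q then P e i else 0))"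
  define hi where "hi = (\<lambda>i j. matern_high d nu S M (y i) (y j))"
  \<comment> \<open>The residual is pinched too, so that its form splits over the same cells as the
    kernel; its diagonal is unaffected.\<close>
  define B where "B = (\<lambda>i j. if cell i = cell j then \<eta> * hi i j else 0)"
  have finE: "finite E" unfolding E_def by simp
  have finJ: "finite J" unfolding J_def using finA finE by simp
  have cardJ: "card J = (2 * n + 1) ^ d * (M * M ^ d)"
    unfolding J_def E_def by (simp add: card_cartesian_product cardA card_exponent_box)
  let ?r = "\<lambda>q v i. if cell i = q then v i else 0 :: real"
  have hi: "psd T hi" unfolding hi_def by (rule psd_matern_high[OF nu S y1])
  have qB: "qform T B v = (\<Sum>q\<in>A. \<eta> * qform T hi (?r q v))" for v
    unfolding B_def qform_pinch[OF finA cellA] qform_cmult ..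
  have "ln (detn T (\<lambda>i j. (if i = j then 1 else 0) + \<eta> * k_Matern d nu l (xs i) (xs j)))
     \<le> (\<Sum>a\<in>J. ln (1 + (\<Sum>i<T. (f a i)\<^sup>2))) + (\<Sum>i<T. B i i)"
  proof (rule ln_detn_le[where c = cell and B = B and f = f, OF finJ])
    show "psd T (\<lambda>i j. \<eta> * k_Matern d nu l (xs i) (xs j))"
      unfolding k_Matern_eq_mixture[OF nu l] using nu l by (intro psd_cmult psd_gauss_mixture \<eta>) auto
    show "psd T B" unfolding psd_def
    proof (intro conjI allI impI)
      fix v show "0 \<le> qform T B v"
        unfolding qB using hi \<eta> by (intro sum_nonneg mult_nonneg_nonneg) (auto simp: psd_def)
    qed (use hi in \<open>auto simp: B_def psd_def\<close>)
    fix v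
    have "qform T (\<lambda>i j. if cell i = cell j then \<eta> * k_Matern d nu l (xs i) (xs j) else 0) v
        = qform T (\<lambda>i j. if cell i = cell j then \<eta> * mix i j else 0) v"
      by (intro qform_cong) (auto simp: kmix)
    also have "\<dots> = (\<Sum>q\<in>A. \<eta> * qform T mix (?r q v))"
      unfolding qform_pinch[OF finA cellA] qform_cmult ..
    also have "\<dots> \<le> (\<Sum>q\<in>A. \<eta> * (c * (\<Sum>e\<in>E. (\<Sum>i<T. P e i * ?r q v i)\<^sup>2) + qform T hi (?r q v)))"
    proof (intro sum_mono mult_left_mono \<eta>)
      fix q
      show "qform T mix (?r q v) \<le> c * (\<Sum>e\<in>E. (\<Sum>i<T. P e i * ?r q v i)\<^sup>2) + qform T hi (?r q v)"
        using qform_gauss_mixture_le[OF nu S y1, where n = T and v = "?r q v" and M = M]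
        unfolding mix_def c_def E_def P_def hi_def by (simp add: case_prod_unfold)
    qed
    also have "\<dots> = (\<Sum>q\<in>A. \<Sum>e\<in>E. \<eta> * c * (\<Sum>i<T. P e i * ?r q v i)\<^sup>2) + qform T B v"
      unfolding qB by (simp add: distrib_left sum.distrib sum_distrib_left mult.assoc)
    also have "(\<Sum>q\<in>A. \<Sum>e\<in>E. \<eta> * c * (\<Sum>i<T. P e i * ?r q v i)\<^sup>2) = (\<Sum>a\<in>J. (\<Sum>i<T. f a i * v i)\<^sup>2)"
    proof -
      have "(\<Sum>i<T. f (q, e) i * v i) = sqrt (\<eta> * c) * (\<Sum>i<T. P e i * ?r q v i)" for q e
        unfolding f_def sum_distrib_left by (intro sum.cong refl) auto
      then have "(\<Sum>i<T. f (q, e) i * v i)\<^sup>2 = \<eta> * c * (\<Sum>i<T. P e i * ?r q v i)\<^sup>2" for q e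
        using \<eta> c by (simp only: power_mult_distrib) simp
      then show ?thesis unfolding J_def sum.cartesian_product' by simp
    qed
    finally show "qform T (\<lambda>i j. if cell i = cell j then \<eta> * k_Matern d nu l (xs i) (xs j) else 0) v
       \<le> (\<Sum>a\<in>J. (\<Sum>i<T. f a i * v i)\<^sup>2) + qform T B v" .
  qed
  also have "\<dots> \<le> (\<Sum>a\<in>J. ln (1 + c * (real T * \<eta>)))
      + (\<Sum>i<T. \<eta> * ((real d * 2 ^ M + 2 * exp 4) * (2 * exp (1/2)) * S powr nu))"
  proof (intro add_mono sum_mono)
    fix a assume "a \<in> J"
    obtain q k \<alpha> where a: "a = (q, k, \<alpha>)" by (metis prod_cases3)
    have "(f a i)\<^sup>2 \<le> \<eta> * c" for i
    proof -
      have "(P (k, \<alpha>) i)\<^sup>2 = (sqnorm d (y i) ^ k)\<^sup>2 * (monom_at d \<alpha> (y i))\<^sup>2"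
        unfolding P_def by (simp add: power_mult_distrib)
      also have "\<dots> \<le> 1 * 1"
        using y1[of i] sqnorm_nonneg[of d "y i"]
        by (intro mult_mono monom_at_sq_le) (auto intro!: power_le_one)
      finally have "(if cell i = q then P (k, \<alpha>) i else 0)\<^sup>2 \<le> 1" by simp
      then have "\<eta> * c * (if cell i = q then P (k, \<alpha>) i else 0)\<^sup>2 \<le> \<eta> * c * 1"
        using \<eta> c by (intro mult_left_mono) auto
      then show ?thesis unfolding a f_def case_prod_conv power_mult_distrib using \<eta> c by simp
    qed
    then have "(\<Sum>i<T. (f a i)\<^sup>2) \<le> c * (real T * \<eta>)"
      using sum_bounded_above[of "{..<T}" "\<lambda>i. (f a i)\<^sup>2" "\<eta> * c"] by (simp add: mult_ac)
    then show "ln (1 + (\<Sum>i<T. (f a i)\<^sup>2)) \<le> ln (1 + c * (real T * \<eta>))"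
      by (intro ln_mono) (auto intro!: add_pos_nonneg sum_nonneg)
  next
    fix i assume "i \<in> {..<T}"
    show "B i i \<le> \<eta> * ((real d * 2 ^ M + 2 * exp 4) * (2 * exp (1/2)) * S powr nu)"
      unfolding B_def hi_def using matern_high_diag[OF nu S y1[of i] M] \<eta> by (simp add: mult_left_mono)
  qed
  also have "\<dots> = real ((2 * n + 1) ^ d * (M * M ^ d)) * ln (1 + c * (real T / lam^2))
         + real T / lam^2 * ((real d * 2 ^ M + 2 * exp 4) * (2 * exp (1/2)) * S powr nu)"
    unfolding sum_constant cardJ by (simp add: \<eta>_def)
  finally show ?thesis unfolding info_gain_eq \<eta>_def c_def by simp
qed

text \<open>Bernoulli's inequality. The constant becomes a factor rather than a summand
  \<open>ln c\<close>, which could not be absorbed for small \<open>x\<close>.\<close>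

lemma ln_one_plus_mult_le:
  assumes "0 \<le> (x :: real)" shows "ln (1 + real c * x) \<le> real c * ln (1 + x)"
proof -
  have "1 + real c * x \<le> (1 + x) ^ c" using Bernoulli_inequality[of x c] assms by simp
  then have "ln (1 + real c * x) \<le> ln ((1 + x) ^ c)"
    using assms by (intro ln_mono) (auto intro: add_pos_nonneg)
  then show ?thesis using assms by (simp add: ln_realpow)
qed

text \<open>With about \<open>h\<close> cells per axis the rank costs \<open>h ^ d * L\<close> and
  the trace \<open>X * h powr (- 2 * nu)\<close>, up to constants. Equating the two fixes
  \<open>h\<close>, and the common value \<open>p\<close> is the rate.\<close>

lemma Matern_bound:
  fixes d :: nat and nu :: real
  assumes d: "d \<ge> 1" and nu: "nu > 0"
  shows "\<exists>D E. 0 < D \<and> 0 < E \<and> (\<forall>lam T l. 0 < lam \<longrightarrow> 1 \<le> T \<longrightarrow> 0 < l \<longrightarrow>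
     max_info_gain (k_Matern d nu l) lam T (unit_ball d)
      \<le> D * ln (1 + 2 * real T / lam^2) + E * (real T / (lam^2 * l powr (2 * nu))) powr (real d / (2 * nu + real d))
           * ln (1 + 2 * real T / lam^2) powr (2 * nu / (2 * nu + real d)))"
proof -
  define M where "M = nat \<lceil>2 * nu\<rceil>"
  have M: "2 * nu \<le> real M" unfolding M_def by (rule real_nat_ceiling_ge)
  then have M0: "0 < M" using nu by (cases M) auto
  define D0 where "D0 = real (M * M ^ d) * real (2 * M * 2 ^ (d * M))"
  define E0 where "E0 = (real d * 2 ^ M + 2 * exp 4) * (2 * exp (1/2)) * (nu * real d) powr nu"
  have D0: "0 < D0" using M0 by (simp add: D0_def)
  have E0: "0 \<le> E0" unfolding E0_def by (intro mult_nonneg_nonneg add_nonneg_nonneg) auto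
  define D where "D = 6 ^ d * D0"
  \<comment> \<open>The rank contributes \<open>6 ^ d * D0\<close> and the trace \<open>E0\<close>;
    the rounding of \<open>h\<close> goes into \<open>D\<close>.\<close>
  define E where "E = 6 ^ d * D0 + E0"
  have DE: "0 < D" "0 < E" using D0 E0 by (auto simp: D_def E_def add_pos_nonneg)
  have "max_info_gain (k_Matern d nu l) lam T (unit_ball d)
      \<le> D * ln (1 + 2 * real T / lam^2) + E * (real T / (lam^2 * l powr (2 * nu))) powr (real d / (2 * nu + real d))
           * ln (1 + 2 * real T / lam^2) powr (2 * nu / (2 * nu + real d))"
    if lam: "0 < lam" and T: "1 \<le> T" and l: "0 < l" for lam l :: real and T :: nat
  proof (rule max_info_gain_le)
    fix xs assume xs: "\<And>i. i < T \<Longrightarrow> xs i \<in> unit_ball d"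
    define Y where "Y = real T / lam^2"
    define L where "L = ln (1 + 2 * real T / lam^2)"
    define X where "X = real T / (lam^2 * l powr (2 * nu))"
    have Y: "0 < Y" using T lam by (simp add: Y_def)
    have L: "0 < L" using Y by (simp add: L_def Y_def)
    have LY: "ln (1 + Y) \<le> L" unfolding L_def using Y by (intro ln_mono) (auto simp: Y_def divide_right_mono)
    have X: "0 < X" using T lam l by (simp add: X_def)
    have XY: "X = Y * l powr (- (2 * nu))" by (simp add: X_def Y_def powr_minus field_simps)
    define s where "s = 2 * nu + real d"
    have s: "0 < s" using nu by (simp add: s_def add_pos_nonneg)
    have frac: "real d / s + 2 * nu / s = 1"
      using s by (simp add: s_def add.commute flip: add_divide_distrib)
    \<comment> \<open>The solution of \<open>h ^ d * L = X * h powr (- 2 * nu)\<close>. It need not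
      be an integer and may be below 1, hence the \<open>h + 1\<close> in the count of
      cells.\<close>
    define h where "h = (X / L) powr (1 / s)"
    have h: "0 < h" using X L by (simp add: h_def)
    define n where "n = nat \<lceil>h\<rceil>"
    have hn: "h \<le> real n" unfolding n_def by (rule real_nat_ceiling_ge)
    then have n: "1 \<le> n" using h by (cases n) auto
    have nh: "real n \<le> h + 1" unfolding n_def using h by linarith
    define p where "p = X powr (real d / s) * L powr (2 * nu / s)"
    have p: "0 \<le> p" by (simp add: p_def)
    have pd: "(X / L) powr e = X powr e * L powr (- e)" for e
      unfolding powr_divide powr_minus_divide by simp
    have hd: "h ^ d * L = p"
    proof -
      have "h ^ d = (X / L) powr (real d / s)" using h by (simp add: h_def powr_powr flip: powr_realpow)
      also have "\<dots> = X powr (real d / s) * L powr (- (real d / s))"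
        by (rule pd)
      finally have "h ^ d * L = X powr (real d / s) * (L powr (- (real d / s)) * L powr 1)" using L by simp
      also have "L powr (- (real d / s)) * L powr 1 = L powr (2 * nu / s)"
        unfolding powr_add[symmetric] using frac by (intro arg_cong[of _ _ "\<lambda>e. L powr e"]) linarith
      finally show ?thesis unfolding p_def .
    qed
    have hX: "X * h powr (- (2 * nu)) = p"
    proof -
      have "h powr (- (2 * nu)) = (X / L) powr (- (2 * nu / s))" by (simp add: h_def powr_powr)
      also have "\<dots> = X powr (- (2 * nu / s)) * L powr (2 * nu / s)"
        using pd[of "- (2 * nu / s)"] by simp
      finally have "X * h powr (- (2 * nu)) = (X powr 1 * X powr (- (2 * nu / s))) * L powr (2 * nu / s)" using X by simp
      also have "X powr 1 * X powr (- (2 * nu / s)) = X powr (real d / s)"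
        unfolding powr_add[symmetric] using frac by (intro arg_cong[of _ _ "\<lambda>e. X powr e"]) linarith
      finally show ?thesis unfolding p_def .
    qed
    define S where "S = nu * real d / (real n * l)\<^sup>2"
    have "S powr nu = (nu * real d) powr nu * (real n powr (- (2 * nu)) * l powr (- (2 * nu)))"
    proof -
      have "S powr nu = (nu * real d) powr nu / ((real n * l) powr 2) powr nu"
        unfolding S_def using nu n l by (simp add: powr_divide)
      also have "((real n * l) powr 2) powr nu = real n powr (2 * nu) * l powr (2 * nu)"
        using n l by (simp only: powr_powr) (simp add: powr_mult)
      finally show ?thesis by (simp add: powr_minus_divide)
    qed
    then have "Y * S powr nu = (nu * real d) powr nu * (X * real n powr (- (2 * nu)))"
      by (simp add: XY mult_ac)
    \<comment> \<open>Rounding up only helps the trace, as the exponent is negative.\<close>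
    also have "\<dots> \<le> (nu * real d) powr nu * (X * h powr (- (2 * nu)))"
      using X h hn nu by (intro mult_left_mono powr_mono2') auto
    finally have YS: "Y * S powr nu \<le> (nu * real d) powr nu * p" unfolding hX .
    have 2: "Y * ((real d * 2 ^ M + 2 * exp 4) * (2 * exp (1/2)) * S powr nu) \<le> E0 * p"
    proof -
      have "(real d * 2 ^ M + 2 * exp 4) * (2 * exp (1/2)) * (Y * S powr nu)
         \<le> (real d * 2 ^ M + 2 * exp 4) * (2 * exp (1/2)) * ((nu * real d) powr nu * p)"
        by (intro mult_left_mono YS mult_nonneg_nonneg add_nonneg_nonneg) auto
      then show ?thesis unfolding E0_def by (simp only: mult_ac)
    qed
    have "real ((2 * n + 1) ^ d) \<le> (3 * (h + 1)) ^ d"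
    proof -
      have "real (2 * n + 1) \<le> 3 * (h + 1)" using nh h by simp
      then show ?thesis by (simp only: of_nat_power) (intro power_mono, auto)
    qed
    also have "\<dots> = 3 ^ d * (h + 1) ^ d" by (rule power_mult_distrib)
    also have "\<dots> \<le> 3 ^ d * (2 ^ d * (h ^ d + 1))"
      using h by (intro mult_left_mono power_add_one_le) auto
    also have "\<dots> = 6 ^ d * (h ^ d + 1)" by (simp flip: power_mult_distrib)
    finally have N: "real ((2 * n + 1) ^ d) \<le> 6 ^ d * (h ^ d + 1)" .
    have 1: "real ((2 * n + 1) ^ d * (M * M ^ d)) * ln (1 + real (2 * M * 2 ^ (d * M)) * Y) \<le> 6 ^ d * D0 * (p + L)"
    proof -
      have "ln (1 + real (2 * M * 2 ^ (d * M)) * Y) \<le> real (2 * M * 2 ^ (d * M)) * ln (1 + Y)"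
        using Y by (intro ln_one_plus_mult_le) simp
      also have "\<dots> \<le> real (2 * M * 2 ^ (d * M)) * L" using LY by (intro mult_left_mono) auto
      finally have "real ((2 * n + 1) ^ d * (M * M ^ d)) * ln (1 + real (2 * M * 2 ^ (d * M)) * Y)
        \<le> real ((2 * n + 1) ^ d * (M * M ^ d)) * (real (2 * M * 2 ^ (d * M)) * L)"
        by (intro mult_left_mono) auto
      also have "\<dots> = real ((2 * n + 1) ^ d) * (D0 * L)"
        unfolding D0_def of_nat_mult[of "(2 * n + 1) ^ d"] by (simp only: mult_ac)
      also have "\<dots> \<le> (6 ^ d * (h ^ d + 1)) * (D0 * L)"
        using N D0 L by (intro mult_right_mono) auto
      also have "\<dots> = 6 ^ d * D0 * (h ^ d * L + L)" by (simp add: algebra_simps)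
      finally show ?thesis unfolding hd .
    qed
    have "info_gain (k_Matern d nu l) lam T xs \<le> 1/2 * (6 ^ d * D0 * (p + L) + E0 * p)"
    proof -
      have "info_gain (k_Matern d nu l) lam T xs
        \<le> 1/2 * (real ((2 * n + 1) ^ d * (M * M ^ d)) * ln (1 + real (2 * M * 2 ^ (d * M)) * Y)
           + Y * ((real d * 2 ^ M + 2 * exp 4) * (2 * exp (1/2)) * S powr nu))"
        unfolding S_def Y_def by (rule info_gain_Matern_le[OF nu l n d M xs])
      then show ?thesis by (rule order_trans) (intro mult_left_mono add_mono 1 2, simp)
    qed
    also have "\<dots> \<le> 6 ^ d * D0 * (p + L) + E0 * p"
    proof -
      have half: "1/2 * z \<le> z" if "0 \<le> z" for z :: real using that by simp
      show ?thesis using p L D0 E0 by (intro half) simp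
    qed
    also have "\<dots> = D * L + E * p" by (simp add: D_def E_def algebra_simps)
    finally show "info_gain (k_Matern d nu l) lam T xs \<le> D * ln (1 + 2 * real T / lam^2)
       + E * (real T / (lam^2 * l powr (2 * nu))) powr (real d / (2 * nu + real d))
           * ln (1 + 2 * real T / lam^2) powr (2 * nu / (2 * nu + real d))"
      unfolding p_def L_def X_def s_def by (simp add: mult.assoc)
  qed
  with DE show ?thesis by blast
qed

theorem theorem2:
  shows "\<exists>C::real. C > 0 \<and>
   (\<exists>Cnu :: real \<Rightarrow> real. (\<forall>nu>1/2. Cnu nu > 0) \<and>
   (\<forall>d::nat. d \<ge> 1 \<longrightarrow>
     (\<exists>C1 C2 C3 C4 C5 :: real. C1 > 0 \<and> C2 > 0 \<and> C3 > 0 \<and> C4 > 0 \<and> C5 > 0 \<and>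
      (\<exists>Cdn1 Cdn2 :: real \<Rightarrow> real. (\<forall>nu>1/2. Cdn1 nu > 0 \<and> Cdn2 nu > 0) \<and>
       (\<forall>(lam::real) (T::nat) (l::real). lam > 0 \<longrightarrow> T \<ge> 1 \<longrightarrow> l > 0 \<longrightarrow>
         (let theta = 2 * l^2;
              cd = max 1 (exp ((1 / exp 1) * (real d / 2 - 1)));
              g = max_info_gain (k_SE d l) lam T (unit_ball d);
              L = ln (1 + real T / lam^2)
          in (theta \<le> (exp 1)^2 * cd \<and> real T / (exp 1 - 1) \<ge> lam^2 \<longrightarrow>
                g \<le> C1 / theta ^ d * L ^ (d + 1) + L + C2 * exp (- 2 / theta + 1 / theta^2))
           \<and> (theta > (exp 1)^2 * cd \<longrightarrow>
                g \<le> C3 / (ln (theta / (exp 1 * cd))) ^ d * L ^ (d + 1) + C4 * L + C5))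
         \<and>
         (\<forall>nu::real. nu > 1/2 \<longrightarrow>
           (let CT = max 1 (log 2 (1 + Gamma nu / Cnu nu * ln (real T ^ 2 / lam^2))
                            + 1 / nu * log 2 (real T ^ 2 / (nu * Gamma nu * lam^2)) + 1);
                L2 = ln (1 + 2 * real T / lam^2);
                gbar = Cdn1 nu * L2 + Cdn2 nu * (real T / (lam^2 * l powr (2 * nu))) powr (real d / (2 * nu + real d))
                        * L2 powr (2 * nu / (2 * nu + real d))
            in max_info_gain (k_Matern d nu l) lam T (unit_ball d) \<le> CT * gbar + C)))))))"
proof (rule exI[of _ 1], intro conjI exI[of _ "\<lambda>_. 1 :: real"] allI impI)
  \<comment> \<open>The value 1 chosen for \<open>C\<close> and \<open>Cnu\<close> suffices because
    the logarithmic factor is a maximum with 1, whatever positive value \<open>Cnu\<close>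
    takes.\<close>
  fix d :: nat assume d: "d \<ge> 1"
  define cd where "cd = max 1 (exp ((1 / exp 1) * (real d / 2 - 1)))"
  have cd: "1 \<le> cd" by (simp add: cd_def)
  obtain C1 where C1: "C1 > 0"
    "\<And>lam T l. 0 < lam \<Longrightarrow> 0 < l \<Longrightarrow> 2 * l^2 \<le> (exp 1)^2 * cd \<Longrightarrow> lam^2 \<le> real T / (exp 1 - 1) \<Longrightarrow>
      max_info_gain (k_SE d l) lam T (unit_ball d) \<le> C1 / (2 * l^2) ^ d * ln (1 + real T / lam^2) ^ (d + 1)"
    using SE_small_lengthscale[OF d, of "(exp 1)^2 * cd"] cd by auto
  \<comment> \<open>The condition on \<open>nu\<close> stands below the existential quantifiers, so
    that choice yields constants that are total functions of \<open>nu\<close>.\<close>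
  have "\<forall>nu. \<exists>D E. nu > 1/2 \<longrightarrow> 0 < D \<and> 0 < E \<and> (\<forall>lam T l. 0 < lam \<longrightarrow> 1 \<le> T \<longrightarrow> 0 < l \<longrightarrow>
     max_info_gain (k_Matern d nu l) lam T (unit_ball d)
      \<le> D * ln (1 + 2 * real T / lam^2) + E * (real T / (lam^2 * l powr (2 * nu))) powr (real d / (2 * nu + real d))
           * ln (1 + 2 * real T / lam^2) powr (2 * nu / (2 * nu + real d)))"
    (is "\<forall>nu. \<exists>D E. ?Q nu D E")
  proof
    fix nu :: real show "\<exists>D E. ?Q nu D E"
      using Matern_bound[OF d, of nu] by (cases "nu > 1/2") (simp, blast)
  qed
  then obtain D E where DE: "\<And>nu. ?Q nu (D nu) (E nu)" by metis
  let ?SE = "\<lambda>C1 C2 C3 C4 C5 lam T l.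
      let theta = 2 * l^2;
              cd = max 1 (exp ((1 / exp 1) * (real d / 2 - 1)));
              g = max_info_gain (k_SE d l) lam T (unit_ball d);
              L = ln (1 + real T / lam^2)
          in (theta \<le> (exp 1)^2 * cd \<and> real T / (exp 1 - 1) \<ge> lam^2 \<longrightarrow>
                g \<le> C1 / theta ^ d * L ^ (d + 1) + L + C2 * exp (- 2 / theta + 1 / theta^2))
           \<and> (theta > (exp 1)^2 * cd \<longrightarrow>
                g \<le> C3 / (ln (theta / (exp 1 * cd))) ^ d * L ^ (d + 1) + C4 * L + C5)"
  have SE: "?SE C1 1 (2 ^ d) (2 ^ d) (real d) lam T l" if "lam > 0" "T \<ge> 1" "l > 0" for lam l :: real and T :: nat
  proof -
    have L: "0 \<le> ln (1 + real T / lam^2)" by simp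
    \<comment> \<open>The terms beyond the first are nonnegative, so the estimate with the leading
      term implies this one for \<open>C2 = 1\<close>.\<close>
    have a: "max_info_gain (k_SE d l) lam T (unit_ball d) \<le> C1 / (2 * l^2) ^ d * ln (1 + real T / lam^2) ^ (d + 1)
        + ln (1 + real T / lam^2) + 1 * exp (- 2 / (2 * l^2) + 1 / (2 * l^2)^2)"
      if "2 * l^2 \<le> (exp 1)^2 * cd \<and> real T / (exp 1 - 1) \<ge> lam^2"
      using C1(2)[OF \<open>lam > 0\<close> \<open>l > 0\<close>, of T] that L exp_gt_zero[of "- 2 / (2 * l^2) + 1 / (2 * l^2)^2"] by linarith
    show ?thesis unfolding Let_def cd_def[symmetric]
      using a SE_large_lengthscale[OF d \<open>lam > 0\<close> \<open>l > 0\<close> \<open>T \<ge> 1\<close> cd] by blast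
  qed
  let ?Mat = "\<lambda>Cdn1 Cdn2 lam T l. \<forall>nu::real. nu > 1/2 \<longrightarrow>
           (let CT = max 1 (log 2 (1 + Gamma nu / 1 * ln (real T ^ 2 / lam^2))
                            + 1 / nu * log 2 (real T ^ 2 / (nu * Gamma nu * lam^2)) + 1);
                L2 = ln (1 + 2 * real T / lam^2);
                gbar = Cdn1 nu * L2 + Cdn2 nu * (real T / (lam^2 * l powr (2 * nu))) powr (real d / (2 * nu + real d))
                        * L2 powr (2 * nu / (2 * nu + real d))
            in max_info_gain (k_Matern d nu l) lam T (unit_ball d) \<le> CT * gbar + 1)"
  have Mat: "?Mat D E lam T l" if lam: "lam > 0" and T: "T \<ge> 1" and l: "l > 0" for lam l :: real and T :: nat
  proof (intro allI impI)
    fix nu :: real assume nu: "nu > 1/2"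
    define gbar where "gbar = D nu * ln (1 + 2 * real T / lam^2)
      + E nu * (real T / (lam^2 * l powr (2 * nu))) powr (real d / (2 * nu + real d))
           * ln (1 + 2 * real T / lam^2) powr (2 * nu / (2 * nu + real d))"
    define CT where "CT = max 1 (log 2 (1 + Gamma nu / 1 * ln (real T ^ 2 / lam^2))
                            + 1 / nu * log 2 (real T ^ 2 / (nu * Gamma nu * lam^2)) + 1)"
    have "max_info_gain (k_Matern d nu l) lam T (unit_ball d) \<le> gbar" "0 < D nu" "0 < E nu"
      using DE nu lam T l unfolding gbar_def by blast+
    moreover have "0 \<le> gbar"
      unfolding gbar_def using \<open>0 < D nu\<close> \<open>0 < E nu\<close> by (intro add_nonneg_nonneg mult_nonneg_nonneg) auto
    \<comment> \<open>Enlarging the factor from 1 to \<open>CT\<close> is harmless because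
      \<open>gbar\<close> is nonnegative.\<close>
    then have "1 * gbar \<le> CT * gbar" by (intro mult_right_mono) (auto simp: CT_def)
    ultimately have "max_info_gain (k_Matern d nu l) lam T (unit_ball d) \<le> CT * gbar + 1" by simp
    then show "let CT = max 1 (log 2 (1 + Gamma nu / 1 * ln (real T ^ 2 / lam^2))
                            + 1 / nu * log 2 (real T ^ 2 / (nu * Gamma nu * lam^2)) + 1);
                L2 = ln (1 + 2 * real T / lam^2);
                gbar = D nu * L2 + E nu * (real T / (lam^2 * l powr (2 * nu))) powr (real d / (2 * nu + real d))
                        * L2 powr (2 * nu / (2 * nu + real d))
            in max_info_gain (k_Matern d nu l) lam T (unit_ball d) \<le> CT * gbar + 1"
      unfolding Let_def CT_def gbar_def .
  qed
  have pos: "\<forall>nu>1/2. D nu > 0 \<and> E nu > 0" using DE by blast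
  have "C1 > 0 \<and> (1::real) > 0 \<and> (2::real) ^ d > 0 \<and> (2::real) ^ d > 0 \<and> real d > 0 \<and>
      (\<exists>Cdn1 Cdn2 :: real \<Rightarrow> real. (\<forall>nu>1/2. Cdn1 nu > 0 \<and> Cdn2 nu > 0) \<and>
       (\<forall>(lam::real) (T::nat) (l::real). lam > 0 \<longrightarrow> T \<ge> 1 \<longrightarrow> l > 0 \<longrightarrow>
         ?SE C1 1 (2 ^ d) (2 ^ d) (real d) lam T l \<and> ?Mat Cdn1 Cdn2 lam T l))"
  proof (intro conjI)
    have "(\<forall>nu>1/2. D nu > 0 \<and> E nu > 0) \<and>
       (\<forall>(lam::real) (T::nat) (l::real). lam > 0 \<longrightarrow> T \<ge> 1 \<longrightarrow> l > 0 \<longrightarrow>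
         ?SE C1 1 (2 ^ d) (2 ^ d) (real d) lam T l \<and> ?Mat D E lam T l)"
      by (intro conjI allI impI pos[rule_format] SE Mat[rule_format])
    then show "\<exists>Cdn1 Cdn2 :: real \<Rightarrow> real. (\<forall>nu>1/2. Cdn1 nu > 0 \<and> Cdn2 nu > 0) \<and>
       (\<forall>(lam::real) (T::nat) (l::real). lam > 0 \<longrightarrow> T \<ge> 1 \<longrightarrow> l > 0 \<longrightarrow>
         ?SE C1 1 (2 ^ d) (2 ^ d) (real d) lam T l \<and> ?Mat Cdn1 Cdn2 lam T l)"
      by (intro exI)
  qed (use C1(1) d in auto)
  then show "\<exists>C1 C2 C3 C4 C5 :: real. C1 > 0 \<and> C2 > 0 \<and> C3 > 0 \<and> C4 > 0 \<and> C5 > 0 \<and>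
      (\<exists>Cdn1 Cdn2 :: real \<Rightarrow> real. (\<forall>nu>1/2. Cdn1 nu > 0 \<and> Cdn2 nu > 0) \<and>
       (\<forall>(lam::real) (T::nat) (l::real). lam > 0 \<longrightarrow> T \<ge> 1 \<longrightarrow> l > 0 \<longrightarrow>
         ?SE C1 C2 C3 C4 C5 lam T l \<and> ?Mat Cdn1 Cdn2 lam T l))"
    by (intro exI)
qed simp_all

end
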